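(* Let $P$ be the transition matrix of a time-reversible ergodic Markov chain on $\{0,\ldots,n\}$ ($n\ge1$) with stationary distribution $\pi$, with $\lambda_r\ge 0$, and let $P_{\mathrm{abs}}$, $\hat\pi$, $\widehat P$, $\Lambda_1$, $\Lambda_2$ be as defined in the context. Set $\Lambda:=\Lambda_2\Lambda_1$, an $(r+1)\times(n+1)$ real matrix. Then $\Lambda$ is a quasi-link providing a quasi-intertwining of $(\pi,P_{\mathrm{abs}})$ and $(\hat\pi,\widehat P)$; that is, the rows of $\Lambda$ sum to $1$, $\Lambda P_{\mathrm{abs}}=\widehat P\Lambda$, and $\pi=\hat\pi\Lambda$. Moreover (as a consequence) the law of the hitting time $T_0=\min\{t\ge0:X_t=0\}$ for the chain $X$ with transition matrix $P$ and initial distribution $\pi$ equals the law of the hitting time $\widehat T_0=\min\{t\ge 0:\widehat X_t=0\}$ for the chain $\widehat X$ with transition matrix $\widehat P$ and initial distribution $\hat\pi$.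
   Context: All vectors are row vectors; $\delta_j$ is the vector with $1$ in position $j$ and $0$ elsewhere; $\vec 1$ is the vector of $1$'s; positions are indexed from $0$ for vectors on $\{0,\ldots,n\}$ or $\{0,\ldots,r\}$. Spectra: $P_0$ is $P$ with row $0$ and column $0$ deleted. Regard the (real) spectra $\sigma(P)$, $\sigma(P_0)$ as multisets and remove the multiset $\sigma(P)\cap\sigma(P_0)$ from each; the remaining eigenvalues of $P$ are $\lambda_0\ge\cdots\ge\lambda_r$ and of $P_0$ are $\gamma_1\ge\cdots\ge\gamma_r$; they satisfy $1=\lambda_0>\gamma_1>\lambda_1>\cdots>\gamma_r>\lambda_r>-1$. It is assumed that $\lambda_r\ge0$. $P_{\mathrm{abs}}$ is $P$ with row $0$ replaced by $\delta_0$. Put $\rho_i:=\frac{1-\gamma_i}{1-\lambda_i}$ for $1\le i\le r$. For $0\le k\le r$ let $\pi^*_k\in\mathbb R^{r+1}$ have entries $\pi^*_k(0)=\prod_{j=1}^k\rho_j$; $\pi^*_k(i)=(1-\rho_i)\prod_{1\le j\le k,\,j\ne i}\frac{1-\gamma_j-\rho_j(1-\gamma_i)}{\gamma_i-\gamma_j}$ for $1\le i\le k$; and $\pi_k^*(i)=0$ for $i>k$. Let $\pi^*:=\pi^*_r$. $\Lambda_2$ is the $(r+1)\times(r+1)$ matrix with row $0$ equal to $\delta_0$ and row $i$ ($1\le i\le r$) equal to $\nu_i:=(1-\rho_i)^{-1}(\pi^*_i-\rho_i\pi^*_{i-1})$. $\Lambda_1$ is the following $(r+1)\times(n+1)$ matrix.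 Let $D_0=\mathrm{diag}(\pi(1),\ldots,\pi(n))$ and let $\widetilde U$ be an orthogonal matrix whose rows are left eigenvectors of the symmetric matrix $D_0^{1/2}P_0D_0^{-1/2}$; the rows of $U=\widetilde U D_0^{1/2}$ are then left eigenvectors of $P_0$. Let $n_i$ be the multiplicity of $\gamma_i$ as an eigenvalue of $P_0$ and let $u^i_1,\ldots,u^i_{n_i}$ be the rows of $U$ corresponding to eigenvalue $\gamma_i$. Row $0$ of $\Lambda_1$ is $\delta_0$ and row $i$ ($1\le i\le r$) is $\delta_0+\sum_{j=1}^{n_i}c^i_j\,(-u^i_j\vec1^T\,|\,u^i_j)$, where $(a|u)$ denotes concatenation and the real constants $c^i_j$ are chosen so that $\pi=\pi^*\Lambda_1$ (such constants exist). For $1\le k\le r$ let $\hat\pi_k$ be the probability vector on $\{0,\ldots,k\}$ with $\hat\pi_k(0)=\prod_{i=1}^k\rho_i$, $\hat\pi_k(j)=\rho_k\rho_{k-1}\cdots\rho_{j+1}(1-\rho_j)$ for $1\le j<k$, $\hat\pi_k(k)=1-\rho_k$ (zero at indices above $k$); $\hat\pi_0:=\delta_0$; $\hat\pi:=\hat\pi_r$. The matrix $\widehat P$ on $\{0,\ldots,r\}$ is given by $\widehat P(0,0)=1$; $\widehat P(i,i)=\gamma_i$ for $i>0$; $\widehat P(i,j)=(1-\gamma_i)\hat\pi_{i-1}(j)$ for $j<i$; $\widehat P(i,j)=0$ for $j>i$. *)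

theory Defs
  imports "HOL-Probability.Probability" "Jordan_Normal_Form.Char_Poly"
begin

unbundle no vec_syntax and no inner_syntax

text \<open>Vectors act as row vectors: the row vector \<open>v A\<close> is \<open>A\<^sup>T v\<close>.\<close>

definition row_mult :: "real vec \<Rightarrow> real mat \<Rightarrow> real vec" (infixl "\<^sub>v*" 70) where
  "v \<^sub>v* A = transpose_mat A *\<^sub>v v"

definition left_eigenvector :: "real mat \<Rightarrow> real vec \<Rightarrow> real \<Rightarrow> bool" where
  "left_eigenvector A v k \<longleftrightarrow> eigenvector (transpose_mat A) v k"

section \<open>Finite Markov chains on \<open>{0..<d}\<close>\<close>

definition stochastic_mat :: "real mat \<Rightarrow> bool" where
  "stochastic_mat P \<longleftrightarrow> square_mat P \<and>
     (\<forall>i<dim_row P. \<forall>j<dim_col P. 0 \<le> P $$ (i, j)) \<and>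
     (\<forall>i<dim_row P. (\<Sum>j<dim_col P. P $$ (i, j)) = 1)"

definition prob_vec :: "real vec \<Rightarrow> bool" where
  "prob_vec \<mu> \<longleftrightarrow> (\<forall>i<dim_vec \<mu>. 0 \<le> \<mu> $ i) \<and> (\<Sum>i<dim_vec \<mu>. \<mu> $ i) = 1"

definition irreducible_mat :: "real mat \<Rightarrow> bool" where
  "irreducible_mat P \<longleftrightarrow>
     (\<forall>i<dim_row P. \<forall>j<dim_row P. \<exists>t. (P ^\<^sub>m t) $$ (i, j) > 0)"

definition aperiodic_mat :: "real mat \<Rightarrow> bool" where
  "aperiodic_mat P \<longleftrightarrow>
     (\<forall>i<dim_row P. Gcd {t::nat. t > 0 \<and> (P ^\<^sub>m t) $$ (i, i) > 0} = 1)"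

definition ergodic_mat :: "real mat \<Rightarrow> bool" where
  "ergodic_mat P \<longleftrightarrow> irreducible_mat P \<and> aperiodic_mat P"

definition stationary :: "real vec \<Rightarrow> real mat \<Rightarrow> bool" where
  "stationary \<pi> P \<longleftrightarrow> \<pi> \<in> carrier_vec (dim_row P) \<and> prob_vec \<pi> \<and> \<pi> \<^sub>v* P = \<pi>"

definition time_reversible :: "real vec \<Rightarrow> real mat \<Rightarrow> bool" where
  "time_reversible \<pi> P \<longleftrightarrow>
     (\<forall>i<dim_row P. \<forall>j<dim_row P. \<pi> $ i * P $$ (i, j) = \<pi> $ j * P $$ (j, i))"

definition markov_chain ::
    "'w measure \<Rightarrow> (nat \<Rightarrow> 'w \<Rightarrow> nat) \<Rightarrow> real vec \<Rightarrow> real mat \<Rightarrow> bool" where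
  "markov_chain M X \<mu> P \<longleftrightarrow> prob_space M \<and>
     (\<forall>t. X t \<in> measurable M (count_space {0..<dim_row P})) \<and>
     (\<forall>i<dim_row P. \<P>(\<omega> in M. X 0 \<omega> = i) = \<mu> $ i) \<and>
     (\<forall>t x j. (\<forall>s\<le>t. x s < dim_row P) \<longrightarrow> j < dim_row P \<longrightarrow>
        \<P>(\<omega> in M. \<forall>s\<le>t. X s \<omega> = x s) > 0 \<longrightarrow>
        \<P>(\<omega> in M. X (Suc t) \<omega> = j \<bar> \<forall>s\<le>t. X s \<omega> = x s) = P $$ (x t, j))"

text \<open>The infimum over the empty set is \<open>\<infinity>\<close>.\<close>

definition hitting_time0 :: "(nat \<Rightarrow> 'w \<Rightarrow> nat) \<Rightarrow> 'w \<Rightarrow> enat" where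
  "hitting_time0 X \<omega> = Inf (enat ` {t. X t \<omega> = 0})"

definition law :: "'w measure \<Rightarrow> ('w \<Rightarrow> enat) \<Rightarrow> enat measure" where
  "law M T = distr M (count_space UNIV) T"

section \<open>Quasi-links and quasi-intertwinings\<close>

definition quasi_link :: "real mat \<Rightarrow> bool" where
  "quasi_link L \<longleftrightarrow> (\<forall>i<dim_row L. (\<Sum>j<dim_col L. L $$ (i, j)) = 1)"

definition quasi_intertwining ::
    "real mat \<Rightarrow> real vec \<Rightarrow> real mat \<Rightarrow> real vec \<Rightarrow> real mat \<Rightarrow> bool" where
  "quasi_intertwining L \<mu> P \<mu>' P' \<longleftrightarrow>
     quasi_link L \<and> L * P = P' * L \<and> \<mu> = \<mu>' \<^sub>v* L"

section \<open>Reduced spectra\<close>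

definition del0 :: "real mat \<Rightarrow> real mat" where
  "del0 P = mat_delete P 0 0"

definition absorb0 :: "real mat \<Rightarrow> real mat" where
  "absorb0 P = mat (dim_row P) (dim_col P)
     (\<lambda>(i, j). if i = 0 then (if j = 0 then 1 else 0) else P $$ (i, j))"

text \<open>Real eigenvalues with algebraic multiplicity.\<close>

definition eig_mset :: "real mat \<Rightarrow> real multiset" where
  "eig_mset A = proots (char_poly A)"

definition common_eigs :: "real mat \<Rightarrow> real multiset" where
  "common_eigs P = eig_mset P \<inter># eig_mset (del0 P)"

definition red_rank :: "real mat \<Rightarrow> nat" where
  "red_rank P = size (eig_mset (del0 P) - common_eigs P)"

text \<open>In decreasing order; \<open>lam P\<close> is indexed by \<open>0, \<dots>, red_rank P\<close> and
  \<open>gam P\<close> by \<open>1, \<dots>, red_rank P\<close>.\<close>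

definition lam :: "real mat \<Rightarrow> nat \<Rightarrow> real" where
  "lam P i = rev (sorted_list_of_multiset (eig_mset P - common_eigs P)) ! i"

definition gam :: "real mat \<Rightarrow> nat \<Rightarrow> real" where
  "gam P i = rev (sorted_list_of_multiset (eig_mset (del0 P) - common_eigs P)) ! (i - 1)"

definition rho :: "real mat \<Rightarrow> nat \<Rightarrow> real" where
  "rho P i = (1 - gam P i) / (1 - lam P i)"

section \<open>The matrix \<open>\<Lambda>\<^sub>2\<close>\<close>

definition pi_star :: "real mat \<Rightarrow> nat \<Rightarrow> real vec" where
  "pi_star P k = vec (red_rank P + 1) (\<lambda>i.
     if i = 0 then (\<Prod>j=1..k. rho P j)
     else if i \<le> k then
       (1 - rho P i) * (\<Prod>j\<in>{1..k} - {i}.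
          (1 - gam P j - rho P j * (1 - gam P i)) / (gam P i - gam P j))
     else 0)"

definition nu :: "real mat \<Rightarrow> nat \<Rightarrow> real vec" where
  "nu P i = (1 / (1 - rho P i)) \<cdot>\<^sub>v (pi_star P i - rho P i \<cdot>\<^sub>v pi_star P (i - 1))"

definition Lambda2 :: "real mat \<Rightarrow> real mat" where
  "Lambda2 P = mat (red_rank P + 1) (red_rank P + 1)
     (\<lambda>(i, j). (if i = 0 then unit_vec (red_rank P + 1) 0 else nu P i) $ j)"

section \<open>The matrix \<open>\<Lambda>\<^sub>1\<close>\<close>

text \<open>Row and column \<open>k\<close> of \<open>del0 P\<close> correspond to state \<open>k + 1\<close>; accordingly
  \<open>D0_powr \<pi> a\<close> is the \<open>a\<close>-th power of \<open>diag (\<pi>(1), \<dots>, \<pi>(n))\<close>, whose diagonal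
  entries are positive.\<close>

definition D0_powr :: "real vec \<Rightarrow> real \<Rightarrow> real mat" where
  "D0_powr \<pi> a = mat_diag (dim_vec \<pi> - 1) (\<lambda>k. \<pi> $ (k + 1) powr a)"

definition sym_del0 :: "real vec \<Rightarrow> real mat \<Rightarrow> real mat" where
  "sym_del0 \<pi> P = D0_powr \<pi> (1/2) * del0 P * D0_powr \<pi> (- 1/2)"

definition orthonormal_left_eigenbasis :: "real vec \<Rightarrow> real mat \<Rightarrow> real mat \<Rightarrow> bool" where
  "orthonormal_left_eigenbasis \<pi> P V \<longleftrightarrow>
     V \<in> carrier_mat (dim_row P - 1) (dim_row P - 1) \<and>
     V * transpose_mat V = 1\<^sub>m (dim_row P - 1) \<and>
     (\<forall>k<dim_row V. \<exists>x. left_eigenvector (sym_del0 \<pi> P) (row V k) x)"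

definition U_mat :: "real vec \<Rightarrow> real mat \<Rightarrow> real mat" where
  "U_mat \<pi> V = V * D0_powr \<pi> (1/2)"

definition gam_mult :: "real mat \<Rightarrow> nat \<Rightarrow> nat" where
  "gam_mult P i = count (eig_mset (del0 P)) (gam P i)"

text \<open>\<open>u_row P U i j\<close> (with \<open>1 \<le> j \<le> gam_mult P i\<close>) is the \<open>j\<close>-th row of \<open>U\<close>, from the
  top, among those that are left eigenvectors of \<open>del0 P\<close> for the eigenvalue \<open>gam P i\<close>.\<close>

definition u_row :: "real mat \<Rightarrow> real mat \<Rightarrow> nat \<Rightarrow> nat \<Rightarrow> real vec" where
  "u_row P U i j =
     filter (\<lambda>u. left_eigenvector (del0 P) u (gam P i)) (rows U) ! (j - 1)"

definition ext_row :: "real vec \<Rightarrow> real vec" where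
  "ext_row u = vCons (- (u \<bullet> vec (dim_vec u) (\<lambda>_. 1))) u"

definition Lambda1 :: "real mat \<Rightarrow> real mat \<Rightarrow> (nat \<Rightarrow> nat \<Rightarrow> real) \<Rightarrow> real mat" where
  "Lambda1 P U c = mat (red_rank P + 1) (dim_row P) (\<lambda>(i, l).
     unit_vec (dim_row P) 0 $ l +
       (if i = 0 then 0
        else (\<Sum>j=1..gam_mult P i. c i j * ext_row (u_row P U i j) $ l)))"

section \<open>The dual chain\<close>

text \<open>For \<open>j = k \<ge> 1\<close> the product is empty and the entry is \<open>1 - rho P k\<close>.\<close>

definition pi_hat :: "real mat \<Rightarrow> nat \<Rightarrow> real vec" where
  "pi_hat P k = vec (red_rank P + 1) (\<lambda>j.
     if j = 0 then (\<Prod>i=1..k. rho P i)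
     else if j \<le> k then (\<Prod>i=j+1..k. rho P i) * (1 - rho P j)
     else 0)"

definition P_hat :: "real mat \<Rightarrow> real mat" where
  "P_hat P = mat (red_rank P + 1) (red_rank P + 1) (\<lambda>(i, j).
     if i = j then (if i = 0 then 1 else gam P i)
     else if j < i then (1 - gam P i) * pi_hat P (i - 1) $ j
     else 0)"

end

theory Submission
  imports Defs
begin

text \<open>
  Write \<open>\<pi>\<close> off state 0 as a sum of left eigenvectors \<open>v\<^sub>i\<close> of \<open>P\<^sub>0\<close>, as the hypothesis
  \<open>\<pi> = \<pi>\<^sup>* \<Lambda>\<^sub>1\<close> allows. Multiplying \<open>z I - P\<close> from the left by the row vector
  \<open>(\<pi>(0) | \<Sum>\<^sub>i (1 - \<gamma>\<^sub>i) / (z - \<gamma>\<^sub>i) v\<^sub>i)\<close> clears row 0 outside the corner, so \<open>det (z I - P)\<close> is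
  \<open>det (z I - P\<^sub>0)\<close> times a rational function with simple poles and residues given by the total
  masses of the \<open>v\<^sub>i\<close>. Hence the \<open>\<gamma>\<^sub>i\<close> are distinct and different from 1, and evaluation at 1 and at
  \<open>\<gamma>\<^sub>i\<close> yields \<open>\<pi>(0) = \<Prod>\<^sub>i \<rho>\<^sub>i\<close> and that \<open>v\<^sub>i\<close> has mass \<open>\<pi>\<^sup>*(i) \<noteq> 0\<close>; that is, column 0 of
  \<open>\<Lambda>\<^sub>1\<close> is a unit vector.

  By construction \<open>\<Lambda>\<^sub>1\<close> intertwines \<open>P\<^sub>a\<^sub>b\<^sub>s\<close> with the star-shaped chain that jumps from \<open>i\<close> to 0 with
  probability \<open>1 - \<gamma>\<^sub>i\<close>, and \<open>\<Lambda>\<^sub>2\<close> intertwines the latter with the dual chain; a partial fraction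
  expansion shows that each \<open>\<pi>\<^sup>*\<^sub>k\<close> has total mass 1. Intertwining alone does not identify the hitting
  times; that column 0 of the link is a unit vector does.
\<close>

section \<open>Partial fractions and real-rooted polynomials\<close>

text \<open>As functions of \<open>y\<close>, both sides have at most simple poles at the
  \<open>a i\<close>, the same residues there and the same limit at infinity. The formal argument is
  an induction on \<open>k\<close> with \<open>y\<close> arbitrary, because the hypothesis is needed
  both at \<open>y\<close> and at the new pole.\<close>

lemma partial_fraction_expansion:
  fixes a \<rho> :: "nat \<Rightarrow> real"
  assumes "inj_on a {1..k}" "\<And>i. i \<in> {1..k} \<Longrightarrow> a i \<noteq> y"
  shows "(\<Prod>j=1..k. (a j - \<rho> j * y) / (a j - y)) = (\<Prod>j=1..k. \<rho> j) +
    (\<Sum>i=1..k. a i * ((1 - \<rho> i) * (\<Prod>j\<in>{1..k} - {i}. (a j - \<rho> j * a i) / (a j - a i))) / (a i - y))"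
  using assms
proof (induction k arbitrary: y)
  case 0
  then show ?case by simp
next
  case (Suc k)
  define A where "A = a (Suc k)"
  define s where "s = \<rho> (Suc k)"
  define W where "W i = (1 - \<rho> i) * (\<Prod>j\<in>{1..k} - {i}. (a j - \<rho> j * a i) / (a j - a i))" for i
  define R where "R = (\<Prod>j=1..k. \<rho> j)"
  have inj: "inj_on a {1..k}" using Suc.prems(1) by (rule inj_on_subset) auto
  have ne: "a i \<noteq> A" if "i \<in> {1..k}" for i
    using that inj_onD[OF Suc.prems(1), of i "Suc k"] by (auto simp: A_def)
  have neA: "A \<noteq> y" using Suc.prems(2)[of "Suc k"] by (auto simp: A_def)
  have ney: "a i \<noteq> y" if "i \<in> {1..k}" for i using Suc.prems(2)[of i] that by auto
  have IHy: "(\<Prod>j=1..k. (a j - \<rho> j * y) / (a j - y)) = R + (\<Sum>i=1..k. a i * W i / (a i - y))"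
    using Suc.IH[OF inj ney] unfolding W_def R_def by simp
  \<comment> \<open>At the new pole the hypothesis evaluates the product that forms the coefficient
    of that pole.\<close>
  have IHA: "(\<Prod>j=1..k. (a j - \<rho> j * A) / (a j - A)) = R + (\<Sum>i=1..k. a i * W i / (a i - A))"
    using Suc.IH[OF inj ne] unfolding W_def R_def by simp
  have set: "{1..Suc k} - {i} = insert (Suc k) ({1..k} - {i})" if "i \<in> {1..k}" for i
    using that by auto
  have old: "(1 - \<rho> i) * (\<Prod>j\<in>{1..Suc k} - {i}. (a j - \<rho> j * a i) / (a j - a i))
      = W i * ((A - s * a i) / (A - a i))" if "i \<in> {1..k}" for i
    unfolding set[OF that] by (subst prod.insert) (auto simp: W_def A_def s_def)
  have new: "(1 - \<rho> (Suc k)) * (\<Prod>j\<in>{1..Suc k} - {Suc k}. (a j - \<rho> j * a (Suc k)) / (a j - a (Suc k)))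
      = (1 - s) * (R + (\<Sum>i=1..k. a i * W i / (a i - A)))"
  proof -
    have "{1..Suc k} - {Suc k} = {1..k}" by auto
    then show ?thesis using IHA by (simp add: A_def s_def)
  qed
  \<comment> \<open>A product of two simple poles is split again; the parts at \<open>A\<close>
    contribute to the coefficient in \<open>new\<close>.\<close>
  have split: "a i * W i / (a i - y) * ((A - s * y) / (A - y)) =
      a i * (W i * ((A - s * a i) / (A - a i))) / (a i - y) + A * (1 - s) / (A - y) * (a i * W i / (a i - A))"
    if "i \<in> {1..k}" for i
  proof -
    have *: "(A - s * y) / ((a i - y) * (A - y)) =
      ((A - s * a i) / (A - a i)) / (a i - y) + A * (1 - s) / (A - y) / (a i - A)"
      using ne[OF that] neA ney[OF that] by (simp add: divide_simps) (simp add: algebra_simps)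
    have "a i * W i / (a i - y) * ((A - s * y) / (A - y))
        = a i * W i * ((A - s * y) / ((a i - y) * (A - y)))" by simp
    also have "\<dots> = a i * W i * (((A - s * a i) / (A - a i)) / (a i - y) + A * (1 - s) / (A - y) / (a i - A))"
      by (simp only: *)
    finally show ?thesis by (simp add: algebra_simps)
  qed
  have "(\<Prod>j=1..Suc k. (a j - \<rho> j * y) / (a j - y))
      = (R + (\<Sum>i=1..k. a i * W i / (a i - y))) * ((A - s * y) / (A - y))"
    using IHy by (simp add: A_def s_def)
  also have "\<dots> = R * ((A - s * y) / (A - y)) + (\<Sum>i=1..k. a i * W i / (a i - y) * ((A - s * y) / (A - y)))"
    by (simp only: distrib_right sum_distrib_right)
  also have "(\<Sum>i=1..k. a i * W i / (a i - y) * ((A - s * y) / (A - y))) =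
      (\<Sum>i=1..k. a i * (W i * ((A - s * a i) / (A - a i))) / (a i - y))
      + A * (1 - s) / (A - y) * (\<Sum>i=1..k. a i * W i / (a i - A))"
    unfolding sum_distrib_left sum.distrib[symmetric] by (rule sum.cong[OF refl split])
  also have "(A - s * y) / (A - y) = s + A * (1 - s) / (A - y)"
    using neA by (simp add: field_simps)
  also have "R * (s + A * (1 - s) / (A - y)) + ((\<Sum>i=1..k. a i * (W i * ((A - s * a i) / (A - a i))) / (a i - y))
      + A * (1 - s) / (A - y) * (\<Sum>i=1..k. a i * W i / (a i - A)))
    = R * s + ((\<Sum>i=1..k. a i * (W i * ((A - s * a i) / (A - a i))) / (a i - y))
        + A * ((1 - s) * (R + (\<Sum>i=1..k. a i * W i / (a i - A)))) / (A - y))"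
    by (simp add: algebra_simps add_divide_distrib diff_divide_distrib)
  also have "(\<Sum>i=1..k. a i * (W i * ((A - s * a i) / (A - a i))) / (a i - y))
      = (\<Sum>i=1..k. a i * ((1 - \<rho> i) * (\<Prod>j\<in>{1..Suc k} - {i}. (a j - \<rho> j * a i) / (a j - a i))) / (a i - y))"
    by (rule sum.cong[OF refl]) (simp only: old)
  finally show ?case
    unfolding new[symmetric] by (simp add: R_def A_def s_def del: times_divide_eq_right)
qed

text \<open>Roots are split off one at a time. The hypothesis ranges over complex roots because the
  fundamental theorem of algebra supplies a complex one, while \<open>proots\<close> sees only real
  ones.\<close>

lemma real_rooted_imp_linear_factors:
  fixes p :: "real poly"
  assumes "p \<noteq> 0" "\<And>z. poly (map_poly complex_of_real p) z = 0 \<Longrightarrow> z \<in> \<real>"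
  shows "size (proots p) = degree p \<and>
    p = Polynomial.smult (lead_coeff p) (\<Prod>x\<in>#proots p. [:- x, 1:])"
  using assms
proof (induction "degree p" arbitrary: p)
  case 0
  then obtain c where "p = [:c:]" by (metis degree_eq_zeroE)
  then show ?case by simp
next
  case (Suc d)
  interpret of_real_poly_hom: map_poly_inj_idom_hom complex_of_real ..
  have "\<not> constant (poly (map_poly complex_of_real p))"
    using Suc(2) by (simp add: constant_degree)
  then obtain z where z: "poly (map_poly complex_of_real p) z = 0"
    using fundamental_theorem_of_algebra by blast
  then obtain a where a: "z = complex_of_real a" using Suc.prems(2) by (auto elim: Reals_cases)
  have "poly p a = 0" using z unfolding a of_real_hom.poly_map_poly by simp
  then obtain q where q: "p = [:- a, 1:] * q" by (auto simp: poly_eq_0_iff_dvd dvd_def)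
  have q0: "q \<noteq> 0" using Suc.prems q by auto
  have deg: "degree p = Suc (degree q)" unfolding q using q0 by (subst degree_mult_eq) auto
  have IH: "size (proots q) = degree q"
    "q = Polynomial.smult (lead_coeff q) (\<Prod>x\<in>#proots q. [:- x, 1:])"
  proof -
    have "w \<in> \<real>" if "poly (map_poly complex_of_real q) w = 0" for w
      using that by (intro Suc.prems(2)) (simp add: q hom_distribs)
    then show "size (proots q) = degree q"
      "q = Polynomial.smult (lead_coeff q) (\<Prod>x\<in>#proots q. [:- x, 1:])"
      using Suc.hyps(1)[OF _ q0] deg Suc(2) by auto
  qed
  have roots: "proots p = {#a#} + proots q"
    unfolding q using q0 proots_linear_factor[of "- a"] by (subst proots_mult) auto
  have "lead_coeff p = lead_coeff q" unfolding q by (subst lead_coeff_mult) simp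
  moreover have "p = Polynomial.smult (lead_coeff q) ([:- a, 1:] * (\<Prod>x\<in>#proots q. [:- x, 1:]))"
    using q IH(2) by (metis mult_smult_right)
  moreover have "(\<Prod>x\<in>#proots p. [:- x, 1:]) = [:- a, 1:] * (\<Prod>x\<in>#proots q. [:- x, 1:])"
    by (simp only: roots image_mset_union image_mset_single prod_mset.union prod_mset_singleton)
  ultimately have "p = Polynomial.smult (lead_coeff p) (\<Prod>x\<in>#proots p. [:- x, 1:])"
    by (simp only:)
  then show ?case using deg roots IH(1) by simp
qed

section \<open>Eigenvalues of stochastic matrices\<close>

text \<open>Reversibility makes \<open>P\<close> self-adjoint for the inner product with weights
  \<pi>. For an eigenvector \<open>v\<close> the form \<open><v, P v>\<close>, called
  \<open>S\<close>, is then real, and it is \<open>z\<close> times the positive squared norm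
  \<open>N\<close>.\<close>

lemma reversible_imp_real_eigenvalue:
  assumes P: "P \<in> carrier_mat m m" and rev: "time_reversible \<pi> P"
    and pos: "\<And>i. i < m \<Longrightarrow> \<pi> $ i > 0"
    and z: "poly (map_poly complex_of_real (char_poly P)) z = 0"
  shows "z \<in> \<real>"
proof -
  let ?A = "map_mat complex_of_real P"
  have A: "?A \<in> carrier_mat m m" using P by simp
  have "eigenvalue ?A z"
    using z of_real_hom.char_poly_hom[OF P] eigenvalue_root_char_poly[OF A] by metis
  then obtain v where v: "v \<in> carrier_vec m" "v \<noteq> 0\<^sub>v m" "?A *\<^sub>v v = z \<cdot>\<^sub>v v"
    using A unfolding eigenvalue_def eigenvector_def by auto
  have ev: "(\<Sum>j<m. of_real (P $$ (i, j)) * v $ j) = z * v $ i" if "i < m" for i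
  proof -
    have "(\<Sum>j<m. of_real (P $$ (i, j)) * v $ j) = (?A *\<^sub>v v) $ i"
      using that P v(1) by (auto simp: scalar_prod_def lessThan_atLeast0 intro!: sum.cong)
    then show ?thesis using v that by simp
  qed
  define N where "N = (\<Sum>i<m. \<pi> $ i * (cmod (v $ i))\<^sup>2)"
  define S where "S = (\<Sum>i<m. \<Sum>j<m. of_real (\<pi> $ i * P $$ (i, j)) * (cnj (v $ i) * v $ j))"
  have "S = (\<Sum>i<m. of_real (\<pi> $ i) * cnj (v $ i) * (\<Sum>j<m. of_real (P $$ (i, j)) * v $ j))"
    unfolding S_def sum_distrib_left by (intro sum.cong refl) (simp add: mult_ac)
  also have "\<dots> = (\<Sum>i<m. of_real (\<pi> $ i) * cnj (v $ i) * (z * v $ i))"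
    using ev by simp
  also have "\<dots> = z * of_real N"
    unfolding N_def of_real_sum sum_distrib_left
    by (intro sum.cong refl) (simp only: of_real_mult complex_norm_square, simp add: mult_ac)
  finally have S1: "S = z * of_real N" .
  have "cnj S = (\<Sum>i<m. \<Sum>j<m. of_real (\<pi> $ i * P $$ (i, j)) * (cnj (v $ j) * v $ i))"
    unfolding S_def by (simp add: mult_ac)
  also have "\<dots> = (\<Sum>j<m. \<Sum>i<m. of_real (\<pi> $ i * P $$ (i, j)) * (cnj (v $ j) * v $ i))"
    by (rule sum.swap)
  also have "\<dots> = S"
    unfolding S_def using rev P by (intro sum.cong refl) (auto simp: time_reversible_def)
  finally have "cnj S = S" .
  moreover have "N \<noteq> 0"
  proof -
    obtain i where i: "i < m" "v $ i \<noteq> 0"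
      using v by (metis carrier_vecD eq_vecI index_zero_vec)
    have "N > 0" unfolding N_def
      by (rule sum_pos2[of _ i]) (use i pos in \<open>auto intro!: mult_nonneg_nonneg mult_pos_pos simp: less_imp_le\<close>)
    then show ?thesis by simp
  qed
  ultimately have "cnj z = z" unfolding S1 by simp
  then show ?thesis by (simp add: Reals_cnj_iff)
qed

text \<open>Rows of \<open>P\<close> average, so at a coordinate of \<open>v\<close> with maximal
  modulus the eigenvalue equation cannot enlarge the modulus.\<close>

lemma stochastic_eigenvalue_le_1:
  assumes P: "P \<in> carrier_mat m m" and st: "stochastic_mat P"
    and z: "poly (char_poly P) z = 0"
  shows "z \<le> 1"
proof -
  obtain v where v: "v \<in> carrier_vec m" "v \<noteq> 0\<^sub>v m" "P *\<^sub>v v = z \<cdot>\<^sub>v v"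
    using z eigenvalue_root_char_poly[OF P] P unfolding eigenvalue_def eigenvector_def by auto
  obtain k where k: "k < m" "v $ k \<noteq> 0"
    using v by (metis carrier_vecD eq_vecI index_zero_vec)
  define M where "M = Max ((\<lambda>i. \<bar>v $ i\<bar>) ` {..<m})"
  have le: "\<bar>v $ i\<bar> \<le> M" if "i < m" for i unfolding M_def using that by (intro Max_ge) auto
  have "M \<in> (\<lambda>i. \<bar>v $ i\<bar>) ` {..<m}" unfolding M_def using k by (intro Max_in) auto
  then obtain i where i: "i < m" "\<bar>v $ i\<bar> = M" by auto
  have M: "M > 0" using le[OF k(1)] k(2) by simp
  have "z * v $ i = (P *\<^sub>v v) $ i" using v i by simp
  also have "\<dots> = (\<Sum>j<m. P $$ (i, j) * v $ j)"
    using i P v(1) by (auto simp: scalar_prod_def lessThan_atLeast0 intro!: sum.cong)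
  finally have "\<bar>z\<bar> * M = \<bar>\<Sum>j<m. P $$ (i, j) * v $ j\<bar>" using i(2) by (metis abs_mult)
  also have "\<dots> \<le> (\<Sum>j<m. P $$ (i, j) * M)"
    using st P i le by (intro order.trans[OF sum_abs] sum_mono)
      (auto simp: abs_mult stochastic_mat_def intro!: mult_mono)
  also have "\<dots> = M" using st P i by (simp add: stochastic_mat_def sum_distrib_right[symmetric])
  finally show ?thesis using M by simp
qed

section \<open>Deleting a state\<close>

lemma del0_carrier: "P \<in> carrier_mat (Suc n) (Suc n) \<Longrightarrow> del0 P \<in> carrier_mat n n"
  unfolding del0_def using mat_delete_carrier[of P "Suc n" "Suc n"] by simp

lemma del0_index:
  "P \<in> carrier_mat (Suc n) (Suc n) \<Longrightarrow> i < n \<Longrightarrow> j < n \<Longrightarrow> del0 P $$ (i, j) = P $$ (Suc i, Suc j)"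
  unfolding del0_def by (simp add: mat_delete_def)

text \<open>The hypothesis on \<open>y\<close> says that the row vector \<open>(p0 | y)\<close>
  times \<open>z I - P\<close> vanishes outside column 0. Let \<open>E\<close> be the identity with
  its top row replaced by that vector. Then \<open>det (E * Z)\<close> is \<open>p0\<close> times
  the characteristic polynomial of \<open>P\<close> at \<open>z\<close>, and by expansion along row
  0 it is also the corner entry times that of \<open>del0 P\<close>.\<close>

lemma char_poly_del0:
  fixes P :: "real mat"
  assumes P: "P \<in> carrier_mat (Suc n) (Suc n)"
    and sums: "\<And>i. i < Suc n \<Longrightarrow> (\<Sum>j<Suc n. P $$ (i, j)) = 1"
    and y: "\<And>l. l < n \<Longrightarrow> z * y l - (\<Sum>k<n. y k * P $$ (Suc k, Suc l)) = p0 * P $$ (0, Suc l)"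
  shows "p0 * poly (char_poly P) z = (z - 1) * (p0 + (\<Sum>k<n. y k)) * poly (char_poly (del0 P)) z"
proof -
  \<comment> \<open>\<open>char_matrix P z\<close> is \<open>P - z I\<close>; the sign makes
    \<open>Z\<close> equal to \<open>z I - P\<close>.\<close>
  define Z where "Z = - char_matrix P z"
  define E where "E = Matrix.mat (Suc n) (Suc n)
    (\<lambda>(i, j). if i = 0 then (if j = 0 then p0 else y (j - 1)) else if i = j then 1 else 0)"
  have Z: "Z \<in> carrier_mat (Suc n) (Suc n)" and E: "E \<in> carrier_mat (Suc n) (Suc n)"
    using P by (auto simp: Z_def E_def)
  have Z_idx: "Z $$ (i, j) = (if i = j then z else 0) - P $$ (i, j)" if "i < Suc n" "j < Suc n" for i j
    using that P by (auto simp: Z_def char_matrix_def)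
  have Z_sum: "(\<Sum>j<Suc n. Z $$ (i, j)) = z - 1" if "i < Suc n" for i
    using sums[OF that] that by (simp add: Z_idx sum_subtractf del: sum.lessThan_Suc)
  have EZ: "(E * Z) $$ (i, j) = (\<Sum>k<Suc n. E $$ (i, k) * Z $$ (k, j))" if "i < Suc n" "j < Suc n" for i j
    using E Z that by (auto simp: scalar_prod_def lessThan_atLeast0 intro!: sum.cong)
  have EZ0: "(E * Z) $$ (0, j) = p0 * Z $$ (0, j) + (\<Sum>k<n. y k * Z $$ (Suc k, j))" if "j < Suc n" for j
    using that unfolding EZ[OF zero_less_Suc that] sum.lessThan_Suc_shift by (simp add: E_def)
  have zero: "(E * Z) $$ (0, Suc l) = 0" if "l < n" for l
  proof -
    have "(\<Sum>k<n. y k * Z $$ (Suc k, Suc l)) =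
        (\<Sum>k<n. if k = l then y k * z else 0) - (\<Sum>k<n. y k * P $$ (Suc k, Suc l))"
      unfolding sum_subtractf[symmetric] using that
      by (intro sum.cong refl) (auto simp: Z_idx algebra_simps)
    then show ?thesis using that y[OF that] by (simp add: EZ0 Z_idx algebra_simps)
  qed
  \<comment> \<open>The other entries of row 0 vanish, so the corner is the sum of the row, and the
    row sums \<open>z - 1\<close> of \<open>Z\<close> evaluate it.\<close>
  have "(E * Z) $$ (0, 0) = (\<Sum>j<Suc n. (E * Z) $$ (0, j))"
    unfolding sum.lessThan_Suc_shift using zero by simp
  also have "\<dots> = (\<Sum>j<Suc n. p0 * Z $$ (0, j) + (\<Sum>k<n. y k * Z $$ (Suc k, j)))"
    using EZ0 by (intro sum.cong) auto
  also have "\<dots> = p0 * (\<Sum>j<Suc n. Z $$ (0, j)) + (\<Sum>k<n. y k * (\<Sum>j<Suc n. Z $$ (Suc k, j)))"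
    unfolding sum.distrib sum_distrib_left by (subst (2) sum.swap) (rule refl)
  also have "\<dots> = (z - 1) * (p0 + (\<Sum>k<n. y k))"
  proof -
    have "(\<Sum>k<n. y k * (\<Sum>j<Suc n. Z $$ (Suc k, j))) = (\<Sum>k<n. y k) * (z - 1)"
      unfolding sum_distrib_right using Z_sum by (intro sum.cong) auto
    then show ?thesis
      unfolding Z_sum[OF zero_less_Suc] by (simp only: algebra_simps)
  qed
  finally have head: "(E * Z) $$ (0, 0) = (z - 1) * (p0 + (\<Sum>k<n. y k))" .
  have del: "mat_delete (E * Z) 0 0 = - char_matrix (del0 P) z"
  proof (rule eq_matI)
    fix i j assume "i < dim_row (- char_matrix (del0 P) z)" "j < dim_col (- char_matrix (del0 P) z)"
    then have ij: "i < n" "j < n" using del0_carrier[OF P] by (auto simp: char_matrix_def)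
    have "mat_delete (E * Z) 0 0 $$ (i, j) = (E * Z) $$ (Suc i, Suc j)"
      using ij E Z by (simp add: mat_delete_def)
    also have "\<dots> = (\<Sum>k<Suc n. if k = Suc i then Z $$ (k, Suc j) else 0)"
      unfolding EZ[OF Suc_mono[OF ij(1)] Suc_mono[OF ij(2)]] using ij
      by (intro sum.cong) (auto simp: E_def)
    also have "\<dots> = (- char_matrix (del0 P) z) $$ (i, j)"
      using ij del0_carrier[OF P] by (simp add: Z_idx del0_index[OF P] char_matrix_def)
    finally show "mat_delete (E * Z) 0 0 $$ (i, j) = (- char_matrix (del0 P) z) $$ (i, j)" .
  qed (use E Z del0_carrier[OF P] in \<open>auto simp: char_matrix_def\<close>)
  have "det E = p0"
  proof -
    have "det E = (\<Prod>i = 0..<dim_row E. E $$ (i, i))"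
      unfolding prod_list_diag_prod[symmetric]
      by (rule det_upper_triangular[OF _ E]) (auto simp: E_def upper_triangular_def)
    also have "\<dots> = p0"
      unfolding lessThan_atLeast0[symmetric] by (simp add: E_def prod.lessThan_Suc_shift del: prod.lessThan_Suc)
    finally show ?thesis .
  qed
  moreover have "det (E * Z) = (z - 1) * (p0 + (\<Sum>k<n. y k)) * det (- char_matrix (del0 P) z)"
    unfolding laplace_expansion_row[OF mult_carrier_mat[OF E Z] zero_less_Suc] sum.lessThan_Suc_shift
    using zero by (simp add: head cofactor_def del)
  ultimately show ?thesis
    unfolding char_poly_matrix[OF P] char_poly_matrix[OF del0_carrier[OF P]]
    by (simp add: det_mult[OF E Z] Z_def[symmetric])
qed

section \<open>Root multiplicities from simple poles\<close>

lemma poly_eqI_cofinite: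
  fixes p q :: "real poly"
  assumes "finite F" "\<And>z. z \<notin> F \<Longrightarrow> poly p z = poly q z"
  shows "p = q"
proof (rule ccontr)
  assume "p \<noteq> q"
  then have "finite {z. poly (p - q) z = 0}" by (intro poly_roots_finite) simp
  moreover have "UNIV \<subseteq> F \<union> {z. poly (p - q) z = 0}" using assms(2) by auto
  ultimately show False using assms(1) infinite_UNIV_char_0 finite_subset by blast
qed

text \<open>The terms are grouped by the value of \<open>g\<close>, since the \<open>g i\<close> are not yet known to be distinct;
  terms with \<open>g i = 1\<close> vanish.\<close>

lemma order_le_if_simple_poles:
  fixes p q :: "real poly" and g \<alpha> :: "'a \<Rightarrow> real"
  assumes "finite I" and nz: "c \<noteq> 0" "p \<noteq> 0" "q \<noteq> 0"
    and eq: "\<And>z. z \<notin> g ` I \<Longrightarrow> z \<noteq> 1 \<Longrightarrow>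
      c * poly p z = (z - 1) * (c + (\<Sum>i\<in>I. \<alpha> i * (1 - g i) / (z - g i))) * poly q z"
  shows "order x q \<le> order x p + (if x = 1 then 0 else 1)"
proof -
  define \<Gamma> where "\<Gamma> = g ` I - {1}"
  define b where "b h = (\<Sum>i | i \<in> I \<and> g i = h. \<alpha> i)" for h
  define G where "G = (\<Prod>h\<in>\<Gamma>. [:- h, 1:])"
  \<comment> \<open>\<open>Q / G\<close> is the rational factor of \<open>q\<close> in the
    hypothesis, with its denominators cleared.\<close>
  define Q where "Q = [:- 1, 1:] * (Polynomial.smult c G +
    (\<Sum>h\<in>\<Gamma>. Polynomial.smult (b h * (1 - h)) (\<Prod>k\<in>\<Gamma> - {h}. [:- k, 1:])))"
  have fin: "finite \<Gamma>" using \<open>finite I\<close> by (simp add: \<Gamma>_def)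
  have "Polynomial.smult c (p * G) = Q * q"
  proof (rule poly_eqI_cofinite[of "insert 1 (g ` I)"])
    fix z assume z: "z \<notin> insert 1 (g ` I)"
    have "(\<Sum>i\<in>I. \<alpha> i * (1 - g i) / (z - g i)) =
        (\<Sum>h\<in>g ` I. \<Sum>i | i \<in> I \<and> g i = h. \<alpha> i * (1 - g i) / (z - g i))"
      using \<open>finite I\<close> by (rule sum.image_gen)
    also have "\<dots> = (\<Sum>h\<in>g ` I. b h * (1 - h) / (z - h))"
      unfolding b_def by (intro sum.cong refl) (simp add: sum_distrib_right sum_divide_distrib)
    also have "\<dots> = (\<Sum>h\<in>\<Gamma>. b h * (1 - h) / (z - h))"
      unfolding \<Gamma>_def using \<open>finite I\<close> by (intro sum.mono_neutral_right) auto
    finally have regroup: "(\<Sum>i\<in>I. \<alpha> i * (1 - g i) / (z - g i)) = (\<Sum>h\<in>\<Gamma>. b h * (1 - h) / (z - h))" .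
    have "poly G z * (b h * (1 - h) / (z - h)) = b h * (1 - h) * (\<Prod>k\<in>\<Gamma> - {h}. z - k)"
      if "h \<in> \<Gamma>" for h
      using z that unfolding G_def poly_prod \<Gamma>_def
      by (subst prod.remove[of _ h]) (use \<open>finite I\<close> in auto)
    then have "(\<Sum>h\<in>\<Gamma>. b h * (1 - h) * (\<Prod>k\<in>\<Gamma> - {h}. z - k)) =
        poly G z * (\<Sum>h\<in>\<Gamma>. b h * (1 - h) / (z - h))"
      unfolding sum_distrib_left by (intro sum.cong) auto
    moreover have "poly Q z =
        (z - 1) * (c * poly G z + (\<Sum>h\<in>\<Gamma>. b h * (1 - h) * (\<Prod>k\<in>\<Gamma> - {h}. z - k)))"
      unfolding Q_def by (simp add: poly_sum poly_prod algebra_simps)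
    ultimately have "poly Q z = (z - 1) * (c + (\<Sum>h\<in>\<Gamma>. b h * (1 - h) / (z - h))) * poly G z"
      by (simp add: algebra_simps)
    then show "poly (Polynomial.smult c (p * G)) z = poly (Q * q) z"
      using eq[of z] z regroup by simp
  qed (use \<open>finite I\<close> in simp)
  note PG = this
  have G: "G \<noteq> 0" using fin by (simp add: G_def)
  then have "Q * q \<noteq> 0" using PG nz by (metis mult_eq_0_iff smult_eq_0_iff)
  \<comment> \<open>As \<open>order x Q\<close> is nonnegative, the order of \<open>q\<close>
    exceeds that of \<open>p\<close> by at most the order of \<open>G\<close>, whose roots are
    simple and different from 1.\<close>
  then have ord: "order x p + order x G = order x Q + order x q"
    using PG nz G order_mult[of p G x] order_mult[of Q q x] order_smult[of c x "p * G"] by auto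
  have "proots G = mset_set \<Gamma>"
    unfolding G_def using fin
    by (subst proots_prod) (auto simp: proots_linear_factor[of "- _", simplified] sum_multiset_singleton)
  then have "order x G = count (mset_set \<Gamma>) x" using count_proots[OF G] by simp
  also have "\<dots> \<le> (if x = 1 then 0 else 1)"
    using fin by (auto simp: count_mset_set' \<Gamma>_def)
  finally show ?thesis using ord by simp
qed

section \<open>Enumeration of the reduced spectra\<close>

lemma image_mset_nth: "image_mset (\<lambda>i. xs ! i) (mset_set {..<length xs}) = mset xs"
  by (metis lessThan_atLeast0 map_nth mset_map mset_upt)

lemma image_mset_lam:
  assumes "size (eig_mset P - common_eigs P) = Suc r"
  shows "image_mset (lam P) (mset_set {..r}) = eig_mset P - common_eigs P"
  unfolding lam_def lessThan_Suc_atMost[symmetric]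
  using image_mset_nth[of "rev (sorted_list_of_multiset (eig_mset P - common_eigs P))"] assms
  by (simp flip: size_mset)

lemma image_mset_gam:
  "image_mset (gam P) (mset_set {1..red_rank P}) = eig_mset (del0 P) - common_eigs P"
proof -
  let ?xs = "rev (sorted_list_of_multiset (eig_mset (del0 P) - common_eigs P))"
  have "length ?xs = red_rank P" by (simp add: red_rank_def flip: size_mset)
  moreover have "image_mset (gam P) (mset_set {1..red_rank P}) =
      image_mset (\<lambda>i. ?xs ! i) (image_mset (\<lambda>i. i - 1) (mset_set {1..red_rank P}))"
    unfolding multiset.map_comp by (rule image_mset_cong) (simp add: gam_def)
  \<comment> \<open>\<open>gam\<close> counts from 1, the underlying list from 0.\<close>
  moreover have "image_mset (\<lambda>i. i - 1) (mset_set {1..red_rank P}) = mset_set {..<red_rank P}"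
  proof -
    have "bij_betw (\<lambda>i. i - 1) {1..red_rank P} {..<red_rank P}"
      by (rule bij_betw_byWitness[where f' = Suc]) auto
    then show ?thesis by (simp add: image_mset_mset_set bij_betw_def)
  qed
  ultimately show ?thesis using image_mset_nth[of ?xs] by simp
qed

lemma lam_antimono:
  assumes "size (eig_mset P - common_eigs P) = Suc r" "j \<le> r"
  shows "lam P j \<le> lam P 0"
  unfolding lam_def using assms by (intro sorted_rev_nth_mono) (simp_all flip: size_mset)

section \<open>Left eigenvectors\<close>

lemma row_mult_index:
  assumes "v \<in> carrier_vec m" "A \<in> carrier_mat m k" "j < k"
  shows "(v \<^sub>v* A) $ j = (\<Sum>i<m. v $ i * A $$ (i, j))"
  using assms by (simp add: row_mult_def scalar_prod_def lessThan_atLeast0 mult.commute)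

lemma row_mult_carrier: "A \<in> carrier_mat m k \<Longrightarrow> v \<^sub>v* A \<in> carrier_vec k"
  unfolding row_mult_def by (rule carrier_vecI) simp

lemma row_mult_assoc:
  assumes "v \<in> carrier_vec m" "A \<in> carrier_mat m k" "B \<in> carrier_mat k l"
  shows "v \<^sub>v* A \<^sub>v* B = v \<^sub>v* (A * B)"
  unfolding row_mult_def transpose_mult[OF assms(2,3)]
  using assms by (intro assoc_mult_mat_vec[symmetric, of _ l k _ m]) simp_all

lemma index_mult_mat_sum:
  assumes "A \<in> carrier_mat m k" "B \<in> carrier_mat k l" "i < m" "j < l"
  shows "(A * B) $$ (i, j) = (\<Sum>h<k. A $$ (i, h) * B $$ (h, j))"
  using assms by (simp add: scalar_prod_def lessThan_atLeast0)

text \<open>Some state \<open>i\<close> carries mass, some power of \<open>P\<close> leads from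
  \<open>i\<close> to \<open>j\<close> with positive probability, and \<pi> is invariant under that
  power.\<close>

lemma stationary_pos:
  assumes P: "P \<in> carrier_mat m m" and st: "stochastic_mat P" and irr: "irreducible_mat P"
    and \<pi>: "stationary \<pi> P" and j: "j < m"
  shows "\<pi> $ j > 0"
proof -
  have c: "\<pi> \<in> carrier_vec m" using \<pi> P by (simp add: stationary_def)
  have nn: "\<And>i. i < m \<Longrightarrow> \<pi> $ i \<ge> 0" and s: "(\<Sum>i<m. \<pi> $ i) = 1"
    and fix_P: "\<pi> \<^sub>v* P = \<pi>"
    using \<pi> carrier_vecD[OF c] unfolding stationary_def prob_vec_def by simp_all
  have pow: "P ^\<^sub>m t \<in> carrier_mat m m" for t using P by (rule pow_carrier_mat)
  have "\<pi> \<^sub>v* P ^\<^sub>m t = \<pi> \<and> (\<forall>i<m. \<forall>j<m. (P ^\<^sub>m t) $$ (i, j) \<ge> 0)" for t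
  proof (induction t)
    case 0
    then show ?case using c P by (auto simp: row_mult_def)
  next
    case (Suc t)
    have "\<pi> \<^sub>v* P ^\<^sub>m Suc t = \<pi>"
      using row_mult_assoc[OF c pow[of t] P] Suc fix_P by simp
    moreover have "(P ^\<^sub>m Suc t) $$ (i, j) \<ge> 0" if "i < m" "j < m" for i j
    proof -
      have "(P ^\<^sub>m Suc t) $$ (i, j) = (\<Sum>h<m. (P ^\<^sub>m t) $$ (i, h) * P $$ (h, j))"
        using index_mult_mat_sum[OF pow[of t] P that] by simp
      also have "\<dots> \<ge> 0"
        using Suc that st P by (intro sum_nonneg mult_nonneg_nonneg) (auto simp: stochastic_mat_def)
      finally show ?thesis .
    qed
    ultimately show ?case by blast
  qed
  note pt = this
  have "\<exists>i<m. \<pi> $ i > 0"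
  proof (rule ccontr)
    assume "\<not> ?thesis"
    then have "(\<Sum>i<m. \<pi> $ i) \<le> 0" by (intro sum_nonpos) (meson lessThan_iff not_less)
    then show False using s by simp
  qed
  then obtain i where i: "i < m" "\<pi> $ i > 0" by blast
  then obtain t where t: "(P ^\<^sub>m t) $$ (i, j) > 0"
    using irr P j by (auto simp: irreducible_mat_def)
  have "0 < (\<Sum>k<m. \<pi> $ k * (P ^\<^sub>m t) $$ (k, j))"
    by (rule sum_pos2[of _ i]) (use i t pt[of t] nn j in auto)
  also have "\<dots> = (\<pi> \<^sub>v* P ^\<^sub>m t) $ j" using row_mult_index[OF c pow j] by simp
  finally show ?thesis using pt by simp
qed

lemma left_eigenvector_del0:
  assumes P: "P \<in> carrier_mat (Suc n) (Suc n)" and u: "left_eigenvector (del0 P) u x"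
  shows "dim_vec u = n" "\<And>l. l < n \<Longrightarrow> (\<Sum>k<n. u $ k * P $$ (Suc k, Suc l)) = x * u $ l"
proof -
  have D: "del0 P \<in> carrier_mat n n" using P by (rule del0_carrier)
  have uc: "u \<in> carrier_vec n" and e: "u \<^sub>v* del0 P = x \<cdot>\<^sub>v u"
    using u D by (auto simp: left_eigenvector_def eigenvector_def row_mult_def)
  show "dim_vec u = n" using uc by auto
  show "(\<Sum>k<n. u $ k * P $$ (Suc k, Suc l)) = x * u $ l" if "l < n" for l
    using row_mult_index[OF uc D that] uc that by (simp add: e del0_index[OF P])
qed

text \<open>With \<open>D\<close> and \<open>D'\<close> the powers 1/2 and -1/2 of the diagonal, the
  eigenvector relations read \<open>V (D B D') = X V\<close> with \<open>X\<close> diagonal.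
  Multiplication by \<open>D\<close> from the right gives \<open>U B = X U\<close> for
  \<open>U = V D\<close>, so \<open>B\<close> is similar to \<open>X\<close> and the rows of
  \<open>U\<close> are left eigenvectors for the same eigenvalues.\<close>

lemma eigenbasis_diagonalizes_del0:
  assumes P: "P \<in> carrier_mat (Suc n) (Suc n)" and \<pi>: "\<pi> \<in> carrier_vec (Suc n)"
    and pos: "\<And>i. i < Suc n \<Longrightarrow> \<pi> $ i > 0"
    and V: "orthonormal_left_eigenbasis \<pi> P V"
  obtains x where "char_poly (del0 P) = (\<Prod>k<n. [:- x k, 1:])"
    "U_mat \<pi> V \<in> carrier_mat n n"
    "\<And>k. k < n \<Longrightarrow> left_eigenvector (del0 P) (row (U_mat \<pi> V) k) (x k)"
proof -
  define D where "D = D0_powr \<pi> (1/2)"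
  define D' where "D' = D0_powr \<pi> (- 1/2)"
  define U where "U = U_mat \<pi> V"
  define B where "B = del0 P"
  have B: "B \<in> carrier_mat n n" unfolding B_def using P by (rule del0_carrier)
  have D: "D \<in> carrier_mat n n" and D': "D' \<in> carrier_mat n n"
    using \<pi> by (auto simp: D_def D'_def D0_powr_def mat_diag_def)
  have Vc: "V \<in> carrier_mat n n" and VV: "V * transpose_mat V = 1\<^sub>m n"
    and ev: "\<forall>k<n. \<exists>x. left_eigenvector (sym_del0 \<pi> P) (row V k) x"
    using V P by (auto simp: orthonormal_left_eigenbasis_def)
  have "D * D' = mat_diag n (\<lambda>k. \<pi> $ (k + 1) powr (1/2) * \<pi> $ (k + 1) powr (- 1/2))"
    using \<pi> by (simp add: D_def D'_def D0_powr_def mat_diag_diag)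
  also have "\<dots> = 1\<^sub>m n"
  proof -
    have "\<pi> $ Suc k \<noteq> 0" if "k < n" for k using pos[of "Suc k"] that by simp
    then show ?thesis by (auto simp: mat_diag_def powr_add[symmetric] intro!: eq_matI)
  qed
  finally have DD': "D * D' = 1\<^sub>m n" .
  then have D'D: "D' * D = 1\<^sub>m n" using mat_mult_left_right_inverse[OF D D'] by simp
  obtain x where x: "\<And>k. k < n \<Longrightarrow> left_eigenvector (sym_del0 \<pi> P) (row V k) (x k)"
    using ev by metis
  have A: "sym_del0 \<pi> P = D * B * D'" by (simp add: sym_del0_def D_def D'_def B_def)
  define X where "X = mat_diag n x"
  have X: "X \<in> carrier_mat n n" by (simp add: X_def)
  have VA: "V * (D * B * D') = X * V"
  proof (rule eq_matI)
    fix k j assume "k < dim_row (X * V)" "j < dim_col (X * V)"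
    then have kj: "k < n" "j < n" using Vc X by auto
    have "row V k \<^sub>v* (D * B * D') = x k \<cdot>\<^sub>v row V k"
      using x[OF kj(1)] by (simp add: A left_eigenvector_def eigenvector_def row_mult_def)
    moreover have "(row V k \<^sub>v* (D * B * D')) $ j = (V * (D * B * D')) $$ (k, j)"
      using kj Vc D D' B by (simp add: row_mult_def comm_scalar_prod[of _ n])
    moreover have "(X * V) $$ (k, j) = x k * V $$ (k, j)"
      unfolding X_def mat_diag_mult_left[OF Vc] using kj by simp
    ultimately show "(V * (D * B * D')) $$ (k, j) = (X * V) $$ (k, j)" using kj Vc by simp
  qed (use Vc D' X in auto)
  have U: "U \<in> carrier_mat n n" using Vc D by (simp add: U_def U_mat_def D_def)
  have U_eq: "U = V * D" by (simp add: U_def U_mat_def D_def)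
  have UB: "U * B = X * U"
  proof -
    have "X * U = X * V * D" unfolding U_eq using X Vc D by simp
    also have "\<dots> = V * (D * B * D') * D" unfolding VA ..
    also have "\<dots> = V * (D * B) * (D' * D)"
      using Vc D B D' by (simp add: assoc_mult_mat[of _ n n _ n _ n])
    also have "\<dots> = U * B" unfolding D'D U_eq
      using Vc D B by (simp add: assoc_mult_mat[of _ n n _ n _ n])
    finally show ?thesis by simp
  qed
  \<comment> \<open>The inverse of \<open>U\<close>: orthogonality inverts \<open>V\<close>, and
    positivity of \<pi> makes \<open>D'\<close> the inverse of \<open>D\<close>.\<close>
  define W where "W = D' * transpose_mat V"
  have W: "W \<in> carrier_mat n n" using D' Vc by (simp add: W_def)
  have "U * W = V * (D * D') * transpose_mat V"
    unfolding U_eq W_def using Vc D D' by (simp add: assoc_mult_mat[of _ n n _ n _ n])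
  then have UW: "U * W = 1\<^sub>m n" using DD' VV Vc by simp
  then have WU: "W * U = 1\<^sub>m n" using mat_mult_left_right_inverse[OF U W] by simp
  have "B = W * U * B" using WU B by simp
  also have "\<dots> = W * X * U" using UB W U B X by (simp add: assoc_mult_mat[of _ n n _ n _ n])
  finally have "similar_mat_wit B X W U"
    using WU UW B X W U by (intro similar_mat_witI[of _ _ n]) auto
  then have "char_poly B = char_poly X" by (intro char_poly_similar) (auto simp: similar_mat_def)
  also have "\<dots> = (\<Prod>a\<leftarrow>diag_mat X. [:- a, 1:])"
    by (rule char_poly_upper_triangular[OF X]) (auto simp: X_def mat_diag_def upper_triangular_def)
  also have "diag_mat X = map x [0..<n]" by (auto simp: diag_mat_def X_def mat_diag_def)
  also have "(\<Prod>a\<leftarrow>map x [0..<n]. [:- a, 1:]) = (\<Prod>k<n. [:- x k, 1:])"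
    by (simp add: prod.list_conv_set_nth lessThan_atLeast0)
  finally have 1: "char_poly B = (\<Prod>k<n. [:- x k, 1:])" .
  have 2: "left_eigenvector B (row U k) (x k)" if k: "k < n" for k
  proof -
    have "row U k \<noteq> 0\<^sub>v n"
    proof
      assume "row U k = 0\<^sub>v n"
      then have "(U * W) $$ (k, k) = 0" using U W k by simp
      then show False using UW k by simp
    qed
    moreover have "transpose_mat B *\<^sub>v row U k = x k \<cdot>\<^sub>v row U k"
    proof (rule eq_vecI)
      fix j assume "j < dim_vec (x k \<cdot>\<^sub>v row U k)"
      then have j: "j < n" using U by simp
      have "(transpose_mat B *\<^sub>v row U k) $ j = (U * B) $$ (k, j)"
        using k j U B by (simp add: comm_scalar_prod[of _ n])
      also have "\<dots> = x k * U $$ (k, j)"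
        unfolding UB X_def mat_diag_mult_left[OF U] using k j by simp
      finally show "(transpose_mat B *\<^sub>v row U k) $ j = (x k \<cdot>\<^sub>v row U k) $ j" using k j U by simp
    qed (use U B in auto)
    ultimately show ?thesis using U B k by (simp add: left_eigenvector_def eigenvector_def)
  qed
  show thesis using that[of x] 1 2 U by (simp add: B_def U_def)
qed

lemma eig_mset_linear_factors:
  assumes "char_poly A = (\<Prod>k<n. [:- x k, 1:])"
  shows "eig_mset A = image_mset x (mset_set {..<n})"
  unfolding eig_mset_def assms
  by (subst proots_prod)
    (auto simp: proots_linear_factor[of "- _", simplified] sum_unfold_sum_mset image_mset.compositionality)

text \<open>\<open>u_row\<close> indexes into a filtered list, which is meaningful only within its
  length. Every \<open>k\<close> with \<open>x k = gam P i\<close> passes the filter, so the list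
  has at least \<open>gam_mult P i\<close> entries.\<close>

lemma u_row_left_eigenvector:
  assumes P: "P \<in> carrier_mat (Suc n) (Suc n)" and \<pi>: "\<pi> \<in> carrier_vec (Suc n)"
    and pos: "\<And>i. i < Suc n \<Longrightarrow> \<pi> $ i > 0"
    and V: "orthonormal_left_eigenbasis \<pi> P V" and j: "j \<in> {1..gam_mult P i}"
  shows "left_eigenvector (del0 P) (u_row P (U_mat \<pi> V) i j) (gam P i)"
proof -
  define U where "U = U_mat \<pi> V"
  obtain x where cp: "char_poly (del0 P) = (\<Prod>k<n. [:- x k, 1:])" and U: "U \<in> carrier_mat n n"
    and x: "\<And>k. k < n \<Longrightarrow> left_eigenvector (del0 P) (row U k) (x k)"
    using eigenbasis_diagonalizes_del0[OF P \<pi> pos V] unfolding U_def by metis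
  let ?p = "\<lambda>u. left_eigenvector (del0 P) u (gam P i)"
  have "gam_mult P i = card {k. k < n \<and> x k = gam P i}"
    unfolding gam_mult_def eig_mset_linear_factors[OF cp]
    by (auto simp: count_image_mset' intro!: arg_cong[where f = card])
  also have "\<dots> \<le> card {k. k < length (rows U) \<and> ?p (rows U ! k)}"
  proof (rule card_mono)
    show "{k. k < n \<and> x k = gam P i} \<subseteq> {k. k < length (rows U) \<and> ?p (rows U ! k)}"
      using x U by force
  qed simp
  also have "\<dots> = length (filter ?p (rows U))" by (simp add: length_filter_conv_card)
  finally have "filter ?p (rows U) ! (j - 1) \<in> set (filter ?p (rows U))"
    using j by (intro nth_mem) auto
  then show ?thesis unfolding u_row_def U_def by simp
qed

section \<open>The reduced spectra\<close>

text \<open>\<open>proots\<close> counts only real roots; reversibility makes every complex root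
  real, so none is missing.\<close>

lemma size_eig_mset_reversible:
  assumes P: "P \<in> carrier_mat m m" and rev: "time_reversible \<pi> P"
    and pos: "\<And>i. i < m \<Longrightarrow> \<pi> $ i > 0"
  shows "size (eig_mset P) = m" "char_poly P = (\<Prod>x\<in>#eig_mset P. [:- x, 1:])"
proof -
  have m: "degree (char_poly P) = m" "coeff (char_poly P) m = 1"
    using degree_monic_char_poly[OF P] by auto
  then have "char_poly P \<noteq> 0" by auto
  from real_rooted_imp_linear_factors[OF this] reversible_imp_real_eigenvalue[OF P rev pos] m
  show "size (eig_mset P) = m" "char_poly P = (\<Prod>x\<in>#eig_mset P. [:- x, 1:])"
    by (simp_all add: eig_mset_def)
qed

text \<open>Multiset intersection takes the smaller count, so its removal exhausts each value in at
  least one of the two spectra.\<close>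

lemma common_eigs_disjoint:
  "x \<in># eig_mset P - common_eigs P \<Longrightarrow> x \<notin># eig_mset (del0 P) - common_eigs P"
  by (auto simp: common_eigs_def in_diff_count)

lemma eig_mset_decomp:
  "eig_mset P = eig_mset P - common_eigs P + common_eigs P"
  "eig_mset (del0 P) = eig_mset (del0 P) - common_eigs P + common_eigs P"
  unfolding common_eigs_def by (simp_all only: subset_mset.diff_add subset_mset.inf_le1 subset_mset.inf_le2)

text \<open>\<open>L\<close> stands for \<open>\<Lambda>\<^sub>1\<close>.\<close>

locale stationary_decomposition =
  fixes n :: nat and P L :: "real mat" and \<pi> :: "real vec"
  assumes P: "P \<in> carrier_mat (Suc n) (Suc n)"
    and stochastic: "stochastic_mat P"
    and reversible: "time_reversible \<pi> P"
    and stationary: "stationary \<pi> P"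
    and \<pi>_pos: "\<And>i. i < Suc n \<Longrightarrow> \<pi> $ i > 0"
    and del0_split: "size (eig_mset (del0 P)) = n"
      "char_poly (del0 P) = (\<Prod>x\<in>#eig_mset (del0 P). [:- x, 1:])"
    and L: "L \<in> carrier_mat (Suc (red_rank P)) (Suc n)"
    and L_row0: "\<And>l. l < Suc n \<Longrightarrow> L $$ (0, l) = (if l = 0 then 1 else 0)"
    and L_sum: "\<And>i. i < Suc (red_rank P) \<Longrightarrow> (\<Sum>l<Suc n. L $$ (i, l)) = 1"
    and L_eig: "\<And>i l. i \<in> {1..red_rank P} \<Longrightarrow> l < n \<Longrightarrow>
      (\<Sum>k<n. L $$ (i, Suc k) * P $$ (Suc k, Suc l)) = gam P i * L $$ (i, Suc l)"
    and \<pi>_eq: "\<pi> = pi_star P (red_rank P) \<^sub>v* L"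
begin

abbreviation "r \<equiv> red_rank P"
abbreviation "\<gamma> \<equiv> gam P"
abbreviation "\<mu> \<equiv> lam P"
abbreviation "s \<equiv> pi_star P (red_rank P)"

text \<open>The total mass of the component of \<open>\<pi>\<close> for the eigenvalue \<open>\<gamma> i\<close>; eventually it equals \<open>s $ i\<close>.\<close>

definition weight :: "nat \<Rightarrow> real" where
  "weight i = s $ i * (\<Sum>l<n. L $$ (i, Suc l))"

text \<open>Rows of \<open>L\<close> have mass 1, so the mass off state 0 is what column 0 leaves.
  Knowing \<open>weight i\<close> thus determines \<open>L $$ (i, 0)\<close> when
  \<open>s $ i\<close> is nonzero.\<close>

lemma weight_eq: "i < Suc r \<Longrightarrow> weight i = s $ i * (1 - L $$ (i, 0))"
proof -
  assume "i < Suc r"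
  then have "(\<Sum>l<n. L $$ (i, Suc l)) = 1 - L $$ (i, 0)"
    using L_sum[of i] unfolding sum.lessThan_Suc_shift by simp
  then show ?thesis by (simp add: weight_def)
qed

lemma \<pi>_carrier: "\<pi> \<in> carrier_vec (Suc n)"
  using stationary P by (simp add: stationary_def)

lemma P_sum: "i < Suc n \<Longrightarrow> (\<Sum>j<Suc n. P $$ (i, j)) = 1"
  using stochastic P by (simp add: stochastic_mat_def)

lemma s_carrier: "pi_star P k \<in> carrier_vec (Suc r)"
  by (simp add: pi_star_def)

lemma \<pi>_Suc: "l < n \<Longrightarrow> \<pi> $ Suc l = (\<Sum>i=1..r. s $ i * L $$ (i, Suc l))"
proof -
  assume l: "l < n"
  have "\<pi> $ Suc l = (s \<^sub>v* L) $ Suc l" using \<pi>_eq by simp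
  also have "\<dots> = (\<Sum>i<Suc r. s $ i * L $$ (i, Suc l))"
    using row_mult_index[OF s_carrier L, of "Suc l"] l by simp
  also have "\<dots> = (\<Sum>i\<in>{1..r}. s $ i * L $$ (i, Suc l))"
    using l L_row0[of "Suc l"] by (intro sum.mono_neutral_right) (auto simp: not_le)
  finally show ?thesis .
qed

lemma weight_sum: "\<pi> $ 0 + (\<Sum>i=1..r. weight i) = 1"
proof -
  have "(\<Sum>i<Suc n. \<pi> $ i) = 1"
    using stationary carrier_vecD[OF \<pi>_carrier] by (simp add: stationary_def prob_vec_def)
  moreover have "(\<Sum>l<n. \<pi> $ Suc l) = (\<Sum>i=1..r. weight i)"
    unfolding weight_def sum_distrib_left by (subst sum.swap) (simp add: \<pi>_Suc)
  ultimately show ?thesis unfolding sum.lessThan_Suc_shift by simp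
qed

text \<open>The vector \<open>y\<close> combines the eigenvectors in \<open>L\<close> with
  coefficients \<open>e i\<close> chosen to cancel \<open>z - \<gamma> i\<close>. Applying
  \<open>z I - del0 P\<close> to it from the right therefore gives \<pi> minus \<pi> times
  \<open>del0 P\<close> off state 0, which by stationarity is the inflow from state 0; so
  \<open>char_poly_del0\<close> applies.\<close>

lemma char_poly_resolvent:
  assumes "z \<notin> \<gamma> ` {1..r}"
  shows "\<pi> $ 0 * poly (char_poly P) z =
    (z - 1) * (\<pi> $ 0 + (\<Sum>i=1..r. weight i * (1 - \<gamma> i) / (z - \<gamma> i))) * poly (char_poly (del0 P)) z"
proof -
  define e where "e i = s $ i * (1 - \<gamma> i) / (z - \<gamma> i)" for i
  have e: "e i * (z - \<gamma> i) = s $ i * (1 - \<gamma> i)" if "i \<in> {1..r}" for i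
    using that assms by (auto simp: e_def)
  define y where "y l = (\<Sum>i=1..r. e i * L $$ (i, Suc l))" for l
  have "z * y l - (\<Sum>k<n. y k * P $$ (Suc k, Suc l)) = \<pi> $ 0 * P $$ (0, Suc l)" if l: "l < n" for l
  proof -
    have "(\<Sum>k<n. y k * P $$ (Suc k, Suc l)) =
        (\<Sum>i=1..r. e i * (\<Sum>k<n. L $$ (i, Suc k) * P $$ (Suc k, Suc l)))"
      unfolding y_def sum_distrib_right sum_distrib_left by (subst sum.swap) (simp add: mult_ac)
    also have "\<dots> = (\<Sum>i=1..r. e i * (\<gamma> i * L $$ (i, Suc l)))"
      using L_eig l by (intro sum.cong) auto
    finally have "z * y l - (\<Sum>k<n. y k * P $$ (Suc k, Suc l)) =
        (\<Sum>i=1..r. e i * (z - \<gamma> i) * L $$ (i, Suc l))"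
      unfolding y_def sum_distrib_left by (simp add: sum_subtractf[symmetric] algebra_simps)
    also have "\<dots> = (\<Sum>i=1..r. s $ i * (1 - \<gamma> i) * L $$ (i, Suc l))"
      using e by (intro sum.cong) auto
    also have "\<dots> = \<pi> $ Suc l - (\<Sum>i=1..r. s $ i * (\<gamma> i * L $$ (i, Suc l)))"
      using l by (simp add: \<pi>_Suc sum_subtractf[symmetric] algebra_simps)
    also have "(\<Sum>i=1..r. s $ i * (\<gamma> i * L $$ (i, Suc l))) =
        (\<Sum>i=1..r. s $ i * (\<Sum>k<n. L $$ (i, Suc k) * P $$ (Suc k, Suc l)))"
      using L_eig l by (intro sum.cong) auto
    also have "\<dots> = (\<Sum>k<n. \<pi> $ Suc k * P $$ (Suc k, Suc l))"
      unfolding sum_distrib_left by (subst sum.swap) (simp add: \<pi>_Suc sum_distrib_right sum_distrib_left mult_ac)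
    \<comment> \<open>Stationarity enters here: the term \<open>k = 0\<close> is what survives the
      subtraction.\<close>
    also have "\<pi> $ Suc l = (\<Sum>k<Suc n. \<pi> $ k * P $$ (k, Suc l))"
      using stationary row_mult_index[OF \<pi>_carrier P, of "Suc l"] l by (simp add: stationary_def)
    finally show ?thesis by (simp add: sum.lessThan_Suc_shift del: sum.lessThan_Suc)
  qed
  note * = char_poly_del0[where y = y and z = z and ?p0.0 = "\<pi> $ 0", OF P P_sum this]
  have "(\<Sum>k<n. y k) = (\<Sum>i=1..r. weight i * (1 - \<gamma> i) / (z - \<gamma> i))"
    unfolding y_def weight_def e_def
    by (subst sum.swap) (simp add: sum_distrib_left sum_distrib_right sum_divide_distrib mult_ac)
  then show ?thesis using * by simp
qed

section \<open>Simplicity of the reduced eigenvalues\<close>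

lemma char_poly_nonzero: "char_poly P \<noteq> 0" "char_poly (del0 P) \<noteq> 0"
  using degree_monic_char_poly[OF P] degree_monic_char_poly[OF del0_carrier[OF P]] by auto

text \<open>The reduced count at \<open>x\<close> is the excess, if any, of the order of
  \<open>x\<close> for \<open>del0 P\<close> over that for \<open>P\<close>. The fractions in
  \<open>char_poly_resolvent\<close> have only simple poles, and the numerators
  \<open>1 - \<gamma> i\<close> exclude a pole at 1.\<close>

lemma count_gam: "count (eig_mset (del0 P) - common_eigs P) x \<le> (if x = 1 then 0 else 1)"
proof -
  have "order x (char_poly (del0 P)) \<le> order x (char_poly P) + (if x = 1 then 0 else 1)"
    by (rule order_le_if_simple_poles[of "{1..r}" "\<pi> $ 0" _ _ \<gamma> weight])
      (use char_poly_resolvent char_poly_nonzero \<pi>_pos[of 0] in auto)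
  then show ?thesis
    using char_poly_nonzero by (simp add: common_eigs_def eig_mset_def count_proots)
qed

lemma gam_mem: "i \<in> {1..r} \<Longrightarrow> \<gamma> i \<in># eig_mset (del0 P) - common_eigs P"
  unfolding image_mset_gam[symmetric] by simp

lemma gam_ne_1: "i \<in> {1..r} \<Longrightarrow> \<gamma> i \<noteq> 1"
  using gam_mem[of i] count_gam[of 1] by (auto simp flip: count_greater_zero_iff)

lemma inj_gam: "inj_on \<gamma> {1..r}"
proof (rule inj_onI, rule ccontr)
  fix i j assume ij: "i \<in> {1..r}" "j \<in> {1..r}" "\<gamma> i = \<gamma> j" "i \<noteq> j"
  have "card {i, j} \<le> card {k \<in> {1..r}. \<gamma> k = \<gamma> i}" using ij by (intro card_mono) auto
  also have "\<dots> = count (image_mset \<gamma> (mset_set {1..r})) (\<gamma> i)"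
    by (auto simp: count_image_mset' intro!: arg_cong[where f = card])
  also have "\<dots> \<le> 1" unfolding image_mset_gam using count_gam[of "\<gamma> i"] by (simp split: if_splits)
  finally show False using ij by simp
qed

text \<open>The full spectra have sizes \<open>n + 1\<close> and \<open>n\<close> and lose the same
  common part.\<close>

lemma size_lam: "size (eig_mset P - common_eigs P) = Suc r"
proof -
  have "size (eig_mset P - common_eigs P) + size (common_eigs P) = Suc n"
    using size_eig_mset_reversible(1)[OF P reversible \<pi>_pos] eig_mset_decomp(1)[of P]
    by (metis size_union)
  moreover have "r + size (common_eigs P) = n"
    unfolding red_rank_def using del0_split(1) eig_mset_decomp(2)[of P] by (metis size_union)
  ultimately show ?thesis by simp
qed

lemma lam_mem: "j \<le> r \<Longrightarrow> \<mu> j \<in># eig_mset P - common_eigs P"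
  unfolding image_mset_lam[OF size_lam, symmetric] by simp

lemma lam_ne_gam: "j \<le> r \<Longrightarrow> i \<in> {1..r} \<Longrightarrow> \<mu> j \<noteq> \<gamma> i"
  using lam_mem[of j] gam_mem[of i] common_eigs_disjoint[of "\<gamma> i" P] by auto

lemma lam_le_1: "j \<le> r \<Longrightarrow> \<mu> j \<le> 1"
proof -
  assume "j \<le> r"
  then have "\<mu> j \<in># eig_mset P" using lam_mem in_diffD by fast
  then have "poly (char_poly P) (\<mu> j) = 0"
    using char_poly_nonzero by (simp add: eig_mset_def)
  then show ?thesis by (rule stochastic_eigenvalue_le_1[OF P stochastic])
qed

text \<open>The numerator of the rational function in \<open>char_poly_resolvent\<close>, without its factor \<open>z - 1\<close>.\<close>

definition residue_poly :: "real poly" where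
  "residue_poly = Polynomial.smult (\<pi> $ 0) (\<Prod>i=1..r. [:- \<gamma> i, 1:]) +
    (\<Sum>i=1..r. Polynomial.smult (weight i * (1 - \<gamma> i)) (\<Prod>h\<in>{1..r} - {i}. [:- \<gamma> h, 1:]))"

text \<open>This is \<open>char_poly_resolvent\<close> with the common linear factors
  \<open>C\<close> cancelled and the denominators cleared. Only finitely many \<open>z\<close> are
  excluded, so it holds between polynomials.\<close>

lemma lam_poly:
  "Polynomial.smult (\<pi> $ 0) (\<Prod>j\<le>r. [:- \<mu> j, 1:]) = [:- 1, 1:] * residue_poly"
proof -
  define C where "C = (\<Prod>x\<in>#common_eigs P. [:- x, 1:])"
  have C: "C \<noteq> 0" by (auto simp: C_def prod_mset_zero_iff)
  have PC: "char_poly P = (\<Prod>j\<le>r. [:- \<mu> j, 1:]) * C"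
  proof -
    have "eig_mset P = image_mset \<mu> (mset_set {..r}) + common_eigs P"
      unfolding image_mset_lam[OF size_lam] by (rule eig_mset_decomp)
    then show ?thesis
      unfolding size_eig_mset_reversible(2)[OF P reversible \<pi>_pos, simplified]
      by (simp add: C_def image_mset.compositionality comp_def prod_unfold_prod_mset)
  qed
  have P0C: "char_poly (del0 P) = (\<Prod>i=1..r. [:- \<gamma> i, 1:]) * C"
  proof -
    have "eig_mset (del0 P) = image_mset \<gamma> (mset_set {1..r}) + common_eigs P"
      unfolding image_mset_gam by (rule eig_mset_decomp)
    then show ?thesis
      unfolding del0_split(2)
      by (simp add: C_def image_mset.compositionality comp_def prod_unfold_prod_mset)
  qed
  show ?thesis
  proof (rule poly_eqI_cofinite[of "{z. poly C z = 0} \<union> \<gamma> ` {1..r}"])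
    show "finite ({z. poly C z = 0} \<union> \<gamma> ` {1..r})" using C by (simp add: poly_roots_finite)
    fix z assume z: "z \<notin> {z. poly C z = 0} \<union> \<gamma> ` {1..r}"
    define G where "G = (\<Prod>i=1..r. z - \<gamma> i)"
    have G: "poly (\<Prod>i=1..r. [:- \<gamma> i, 1:]) z = G" by (simp add: G_def poly_prod)
    have "G * (weight i * (1 - \<gamma> i) / (z - \<gamma> i)) = weight i * (1 - \<gamma> i) * (\<Prod>h\<in>{1..r} - {i}. z - \<gamma> h)"
      if "i \<in> {1..r}" for i
      unfolding G_def using that z by (subst prod.remove[of _ i]) auto
    then have "(\<Sum>i=1..r. weight i * (1 - \<gamma> i) * (\<Prod>h\<in>{1..r} - {i}. z - \<gamma> h)) =
        (\<Sum>i=1..r. weight i * (1 - \<gamma> i) / (z - \<gamma> i)) * G"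
      unfolding sum_distrib_right by (intro sum.cong) (auto simp: mult_ac)
    moreover have "poly residue_poly z = \<pi> $ 0 * G +
        (\<Sum>i=1..r. weight i * (1 - \<gamma> i) * (\<Prod>h\<in>{1..r} - {i}. z - \<gamma> h))"
      by (simp add: residue_poly_def poly_sum poly_prod G_def)
    ultimately have "poly residue_poly z =
        (\<pi> $ 0 + (\<Sum>i=1..r. weight i * (1 - \<gamma> i) / (z - \<gamma> i))) * G"
      by (simp only: distrib_right)
    moreover have "\<pi> $ 0 * poly (\<Prod>j\<le>r. [:- \<mu> j, 1:]) z * poly C z =
        (z - 1) * ((\<pi> $ 0 + (\<Sum>i=1..r. weight i * (1 - \<gamma> i) / (z - \<gamma> i))) * G) * poly C z"
      using char_poly_resolvent[of z] z unfolding PC P0C poly_mult G by (simp add: mult.assoc)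
    moreover have "poly C z \<noteq> 0" using z by simp
    ultimately have "\<pi> $ 0 * poly (\<Prod>j\<le>r. [:- \<mu> j, 1:]) z = (z - 1) * poly residue_poly z"
      by simp
    then show "poly (Polynomial.smult (\<pi> $ 0) (\<Prod>j\<le>r. [:- \<mu> j, 1:])) z
        = poly ([:- 1, 1:] * residue_poly) z"
      by (simp add: left_diff_distrib)
  qed
qed

text \<open>The factor \<open>z - 1\<close> in \<open>lam_poly\<close> makes 1 one of the
  \<open>\<mu> j\<close>; all of them are at most 1 and the enumeration is decreasing.\<close>

lemma lam_0: "\<mu> 0 = 1"
proof -
  have "poly (Polynomial.smult (\<pi> $ 0) (\<Prod>j\<le>r. [:- \<mu> j, 1:])) 1 = 0"
    unfolding lam_poly by simp
  then obtain j where "j \<le> r" "\<mu> j = 1" using \<pi>_pos[of 0] by (auto simp: poly_prod)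
  then show ?thesis using lam_antimono[OF size_lam, of j] lam_le_1[of 0] by simp
qed

section \<open>Masses of the components from values of \<open>residue_poly\<close>\<close>

lemma residue_poly_eq: "residue_poly = Polynomial.smult (\<pi> $ 0) (\<Prod>j=1..r. [:- \<mu> j, 1:])"
proof -
  have "{..r} = insert 0 {1..r}" by auto
  then have "(\<Prod>j\<le>r. [:- \<mu> j, 1:]) = [:- 1, 1:] * (\<Prod>j=1..r. [:- \<mu> j, 1:])"
    using lam_0 by simp
  then have "[:- 1, 1:] * residue_poly =
      [:- 1, 1:] * Polynomial.smult (\<pi> $ 0) (\<Prod>j=1..r. [:- \<mu> j, 1:])"
    using lam_poly by (simp only: mult_smult_right)
  then show ?thesis by (subst (asm) mult_cancel_left) simp
qed

text \<open>At 1 the numerator \<open>1 - \<gamma> i\<close> restores the factor missing from the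
  \<open>i\<close>-th product, so the full product comes out with the total mass of \<pi> in front,
  which is 1.\<close>

lemma residue_at_1: "\<pi> $ 0 * (\<Prod>j=1..r. 1 - \<mu> j) = (\<Prod>i=1..r. 1 - \<gamma> i)"
proof -
  define G where "G = (\<Prod>i=1..r. 1 - \<gamma> i)"
  have "weight i * (1 - \<gamma> i) * (\<Prod>h\<in>{1..r} - {i}. 1 - \<gamma> h) = weight i * G" if "i \<in> {1..r}" for i
    unfolding G_def using that by (subst prod.remove[of "{1..r}" i]) auto
  then have "(\<Sum>i=1..r. weight i * (1 - \<gamma> i) * (\<Prod>h\<in>{1..r} - {i}. 1 - \<gamma> h)) = (\<Sum>i=1..r. weight i * G)"
    by (rule sum.cong[OF refl])
  then have "poly residue_poly 1 = \<pi> $ 0 * G + (\<Sum>i=1..r. weight i * G)"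
    by (simp add: residue_poly_def poly_sum poly_prod G_def)
  also have "\<dots> = (\<pi> $ 0 + (\<Sum>i=1..r. weight i)) * G"
    by (simp add: sum_distrib_right distrib_right)
  finally show ?thesis unfolding weight_sum by (simp add: residue_poly_eq poly_prod G_def)
qed

text \<open>Otherwise the left side of \<open>residue_at_1\<close> would vanish, although no
  \<open>\<gamma> i\<close> is 1. This keeps the denominators in \<open>rho\<close> away from
  0.\<close>

lemma lam_ne_1: "j \<in> {1..r} \<Longrightarrow> \<mu> j \<noteq> 1"
proof -
  assume j: "j \<in> {1..r}"
  have "(\<Prod>i=1..r. 1 - \<gamma> i) \<noteq> 0" using gam_ne_1 by auto
  moreover have "(\<Prod>j=1..r. 1 - \<mu> j) = 0" if "\<mu> j = 1" using that j by (intro prod_zero) auto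
  ultimately show ?thesis using residue_at_1 by (metis mult_zero_right)
qed

lemma \<pi>_0: "\<pi> $ 0 = (\<Prod>j=1..r. rho P j)"
proof -
  have "(\<Prod>j=1..r. 1 - \<mu> j) \<noteq> 0" using lam_ne_1 by auto
  then show ?thesis using residue_at_1 by (simp add: rho_def prod_dividef field_simps)
qed

text \<open>Among the summands of \<open>residue_poly\<close> only the \<open>i\<close>-th lacks the
  factor that vanishes at \<open>\<gamma> i\<close>.\<close>

lemma residue_at_gam:
  assumes i: "i \<in> {1..r}"
  shows "\<pi> $ 0 * (\<Prod>j=1..r. \<gamma> i - \<mu> j) = weight i * (1 - \<gamma> i) * (\<Prod>h\<in>{1..r} - {i}. \<gamma> i - \<gamma> h)"
proof -
  have "(\<Prod>h\<in>{1..r} - {k}. \<gamma> i - \<gamma> h) = 0" if "k \<in> {1..r}" "k \<noteq> i" for k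
    using that i by (intro prod_zero) auto
  then have "(\<Sum>k\<in>{1..r} - {i}. weight k * (1 - \<gamma> k) * (\<Prod>h\<in>{1..r} - {k}. \<gamma> i - \<gamma> h)) = 0"
    by (intro sum.neutral ballI) (metis Diff_iff singletonI mult_zero_right)
  then have "(\<Sum>k=1..r. weight k * (1 - \<gamma> k) * (\<Prod>h\<in>{1..r} - {k}. \<gamma> i - \<gamma> h)) =
      weight i * (1 - \<gamma> i) * (\<Prod>h\<in>{1..r} - {i}. \<gamma> i - \<gamma> h)"
    using i by (subst sum.remove[of _ i]) auto
  moreover have "(\<Prod>h=1..r. \<gamma> i - \<gamma> h) = 0" using i by (intro prod_zero) auto
  ultimately have "poly residue_poly (\<gamma> i) = weight i * (1 - \<gamma> i) * (\<Prod>h\<in>{1..r} - {i}. \<gamma> i - \<gamma> h)"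
    by (simp add: residue_poly_def poly_sum poly_prod)
  then show ?thesis by (simp add: residue_poly_eq poly_prod)
qed

lemma rho_ne_1: "i \<in> {1..r} \<Longrightarrow> rho P i \<noteq> 1"
  using lam_ne_gam[of i i] lam_ne_1[of i] by (auto simp: rho_def field_simps)

text \<open>Substituting \<open>1 - \<gamma> j = rho P j * (1 - \<mu> j)\<close> turns each
  numerator into \<open>rho P j * (\<gamma> i - \<mu> j)\<close>, and
  \<open>(1 - rho P i) * (1 - \<gamma> i)\<close> supplies the missing factor for
  \<open>j = i\<close>. The outcome matches \<open>residue_at_gam\<close>, with \<open>s $ i\<close>
  in place of \<open>weight i\<close>.\<close>

lemma pi_star_top:
  assumes i: "i \<in> {1..r}"
  shows "s $ i * ((1 - \<gamma> i) * (\<Prod>h\<in>{1..r} - {i}. \<gamma> i - \<gamma> h)) = \<pi> $ 0 * (\<Prod>j=1..r. \<gamma> i - \<mu> j)"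
proof -
  have ne: "(\<Prod>h\<in>{1..r} - {i}. \<gamma> i - \<gamma> h) \<noteq> 0" using i inj_onD[OF inj_gam, of i] by auto
  have head: "(1 - rho P i) * (1 - \<gamma> i) = rho P i * (\<gamma> i - \<mu> i)"
    using lam_ne_1[OF i] by (simp add: rho_def field_simps)
  have factor: "1 - \<gamma> j - rho P j * (1 - \<gamma> i) = rho P j * (\<gamma> i - \<mu> j)" if "j \<in> {1..r}" for j
    using lam_ne_1[OF that] by (simp add: rho_def field_simps)
  have "s $ i * ((1 - \<gamma> i) * (\<Prod>h\<in>{1..r} - {i}. \<gamma> i - \<gamma> h)) =
      (1 - rho P i) * (1 - \<gamma> i) * (\<Prod>j\<in>{1..r} - {i}. 1 - \<gamma> j - rho P j * (1 - \<gamma> i))"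
    using i ne by (simp add: pi_star_def prod_dividef)
  also have "\<dots> = rho P i * (\<gamma> i - \<mu> i) * (\<Prod>j\<in>{1..r} - {i}. rho P j * (\<gamma> i - \<mu> j))"
    unfolding head using factor by (intro arg_cong2[where f = "(*)"] prod.cong refl) auto
  also have "\<dots> = (\<Prod>j=1..r. rho P j * (\<gamma> i - \<mu> j))"
    using i by (subst (2) prod.remove[of _ i]) auto
  finally show ?thesis by (simp add: \<pi>_0 prod.distrib)
qed

text \<open>Comparing \<open>pi_star_top\<close> with \<open>residue_at_gam\<close> gives
  \<open>weight i = s $ i\<close>. This value is nonzero since no \<open>\<mu> j\<close> equals
  \<open>\<gamma> i\<close>, so \<open>weight_eq\<close> forces the entry to vanish.\<close>

lemma L_col0:
  assumes "i < Suc r"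
  shows "L $$ (i, 0) = (if i = 0 then 1 else 0)"
proof (cases "i = 0")
  case False
  then have i: "i \<in> {1..r}" using assms by auto
  have ne: "(1 - \<gamma> i) * (\<Prod>h\<in>{1..r} - {i}. \<gamma> i - \<gamma> h) \<noteq> 0"
    using i gam_ne_1[OF i] inj_onD[OF inj_gam, of i] by auto
  have "weight i = s $ i"
    using residue_at_gam[OF i] pi_star_top[OF i] ne by (simp add: mult.assoc)
  moreover have "s $ i \<noteq> 0"
    using pi_star_top[OF i] \<pi>_pos[of 0] lam_ne_gam[OF _ i] by fastforce
  ultimately show ?thesis using weight_eq[OF assms] False by simp
qed (use L_row0[of 0] in simp)

end

section \<open>Hitting times\<close>

lemma absorb0_carrier: "P \<in> carrier_mat d d \<Longrightarrow> absorb0 P \<in> carrier_mat d d"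
  by (auto simp: absorb0_def)

lemma absorb0_index:
  "P \<in> carrier_mat d d \<Longrightarrow> i < d \<Longrightarrow> j < d \<Longrightarrow>
    absorb0 P $$ (i, j) = (if i = 0 then (if j = 0 then 1 else 0) else P $$ (i, j))"
  by (simp add: absorb0_def)

lemma hitting_time0_eq_infinity: "hitting_time0 X \<omega> = \<infinity> \<longleftrightarrow> (\<forall>s. X s \<omega> \<noteq> 0)"
proof
  assume *: "hitting_time0 X \<omega> = \<infinity>"
  have "hitting_time0 X \<omega> \<le> enat s" if "X s \<omega> = 0" for s
    unfolding hitting_time0_def using that by (intro Inf_lower) auto
  then show "\<forall>s. X s \<omega> \<noteq> 0" using * by fastforce
next
  assume "\<forall>s. X s \<omega> \<noteq> 0"
  then show "hitting_time0 X \<omega> = \<infinity>" by (simp add: hitting_time0_def Inf_enat_def)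
qed

lemma hitting_time0_le: "hitting_time0 X \<omega> \<le> enat t \<longleftrightarrow> (\<exists>s\<le>t. X s \<omega> = 0)"
proof
  assume *: "hitting_time0 X \<omega> \<le> enat t"
  show "\<exists>s\<le>t. X s \<omega> = 0"
  proof (rule ccontr)
    assume "\<not> ?thesis"
    then have "enat (Suc t) \<le> hitting_time0 X \<omega>"
      unfolding hitting_time0_def by (intro Inf_greatest) (auto simp: not_less_eq_eq)
    then have "enat (Suc t) \<le> enat t" using * by (rule order_trans)
    then show False by simp
  qed
next
  assume "\<exists>s\<le>t. X s \<omega> = 0"
  then obtain s where "s \<le> t" "X s \<omega> = 0" by blast
  then have "hitting_time0 X \<omega> \<le> enat s" "enat s \<le> enat t"
    unfolding hitting_time0_def by (auto intro!: Inf_lower)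
  then show "hitting_time0 X \<omega> \<le> enat t" by (rule order_trans)
qed

section \<open>Survival events and the law of the hitting time\<close>

definition survives :: "'w measure \<Rightarrow> (nat \<Rightarrow> 'w \<Rightarrow> nat) \<Rightarrow> nat \<Rightarrow> 'w set" where
  "survives M X t = {\<omega> \<in> space M. \<forall>s\<le>t. X s \<omega> \<noteq> 0}"

lemma survives_eq: "survives M X t = {\<omega> \<in> space M. enat t < hitting_time0 X \<omega>}"
  unfolding survives_def linorder_not_le[symmetric] hitting_time0_le by auto

lemma survives_sets:
  assumes "\<And>t. X t \<in> measurable M (count_space {0..<d})"
  shows "survives M X t \<in> sets M"
proof -
  have "{\<omega> \<in> space M. X s \<omega> = 0} \<in> sets M" for s
  proof -
    have "X s -` ({0} \<inter> {0..<d}) \<inter> space M \<in> sets M"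
      by (rule measurable_sets[OF assms]) auto
    moreover have "X s -` ({0} \<inter> {0..<d}) \<inter> space M = {\<omega> \<in> space M. X s \<omega> = 0}"
      using measurable_space[OF assms] by fastforce
    ultimately show ?thesis by simp
  qed
  then have "{\<omega> \<in> space M. \<forall>s\<in>{..t}. \<not> X s \<omega> = 0} \<in> sets M"
    by (intro sets.sets_Collect_finite_All sets.sets_Collect_neg) auto
  moreover have "{\<omega> \<in> space M. \<forall>s\<in>{..t}. \<not> X s \<omega> = 0} = survives M X t"
    by (auto simp: survives_def)
  ultimately show ?thesis by simp
qed

text \<open>The level sets of the hitting time are differences of consecutive survival events, and
  their intersection at infinity.\<close>

lemma measure_hitting_time0:
  assumes M: "prob_space M" and X: "\<And>t. X t \<in> measurable M (count_space {0..<d})"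
  shows "hitting_time0 X \<in> measurable M (count_space UNIV)"
    and "measure M (hitting_time0 X -` {enat 0} \<inter> space M) = 1 - measure M (survives M X 0)"
    and "measure M (hitting_time0 X -` {enat (Suc t)} \<inter> space M) =
      measure M (survives M X t) - measure M (survives M X (Suc t))"
    and "(\<lambda>t. measure M (survives M X t)) \<longlonglongrightarrow> measure M (hitting_time0 X -` {\<infinity>} \<inter> space M)"
proof -
  interpret prob_space M by fact
  note [measurable] = survives_sets[where X = X, OF X]
  have e0: "hitting_time0 X -` {enat 0} \<inter> space M = space M - survives M X 0"
    by (auto simp: survives_eq enat_0)
  have eS: "hitting_time0 X -` {enat (Suc t)} \<inter> space M = survives M X t - survives M X (Suc t)" for t
  proof -
    have "a = enat (Suc t) \<longleftrightarrow> enat t < a \<and> \<not> enat (Suc t) < a" for a by (cases a) auto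
    then show ?thesis by (auto simp: survives_eq)
  qed
  have einf: "hitting_time0 X -` {\<infinity>} \<inter> space M = (\<Inter>t. survives M X t)"
    using hitting_time0_eq_infinity[of X] by (auto simp: survives_def)
  have sets: "hitting_time0 X -` {a} \<inter> space M \<in> sets M" for a
  proof (cases a)
    case (enat t)
    then show ?thesis by (cases t) (simp_all only: e0 eS, measurable)
  next
    case infinity
    then show ?thesis unfolding infinity einf by measurable
  qed
  then show "hitting_time0 X \<in> measurable M (count_space UNIV)"
    by (auto simp: measurable_count_space_eq2_countable)
  show "measure M (hitting_time0 X -` {enat 0} \<inter> space M) = 1 - measure M (survives M X 0)"
    unfolding e0 by (rule prob_compl) measurable
  show "measure M (hitting_time0 X -` {enat (Suc t)} \<inter> space M) =
      measure M (survives M X t) - measure M (survives M X (Suc t))"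
    unfolding eS by (rule finite_measure_Diff[OF survives_sets[where X = X, OF X] survives_sets[where X = X, OF X]]) (auto simp: survives_def)
  show "(\<lambda>t. measure M (survives M X t)) \<longlonglongrightarrow> measure M (hitting_time0 X -` {\<infinity>} \<inter> space M)"
    unfolding einf
  proof (rule finite_Lim_measure_decseq)
    show "range (survives M X) \<subseteq> sets M" using survives_sets[where X = X, OF X] by blast
    show "decseq (survives M X)" by (auto simp: decseq_def survives_def)
  qed
qed

text \<open>\<open>enat\<close> is countable, so point masses decide, and survival probabilities
  determine each of them, the one at infinity as a limit.\<close>

lemma law_hitting_time0_eqI:
  fixes M :: "'w measure" and N :: "'v measure"
  assumes M: "prob_space M" and X: "\<And>t. X t \<in> measurable M (count_space {0..<d})"
    and N: "prob_space N" and Y: "\<And>t. Y t \<in> measurable N (count_space {0..<e})"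
    and eq: "\<And>t. measure M (survives M X t) = measure N (survives N Y t)"
  shows "law M (hitting_time0 X) = law N (hitting_time0 Y)"
proof -
  interpret M: prob_space M by fact
  interpret N: prob_space N by fact
  note hX = measure_hitting_time0[OF M X] and hY = measure_hitting_time0[OF N Y]
  have "measure M (hitting_time0 X -` {a} \<inter> space M) = measure N (hitting_time0 Y -` {a} \<inter> space N)" for a
  proof (cases a)
    case (enat t)
    then show ?thesis using hX(2,3) hY(2,3) eq by (cases t) auto
  next
    case infinity
    then show ?thesis using LIMSEQ_unique[OF hX(4)] hY(4) eq by simp
  qed
  then show ?thesis unfolding law_def
    by (intro measure_eqI_countable[where A = UNIV])
      (auto simp: emeasure_distr hX(1) hY(1) M.emeasure_eq_measure N.emeasure_eq_measure)
qed

text \<open>The Markov property multiplied out. For a path of probability 0 it says nothing, but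
  then both sides vanish.\<close>

lemma markov_chain_step:
  assumes mc: "markov_chain M X \<mu> P" and P: "P \<in> carrier_mat d d"
    and x: "\<And>s. s \<le> t \<Longrightarrow> x s < d" and j: "j < d"
  shows "measure M {\<omega> \<in> space M. (\<forall>s\<le>t. X s \<omega> = x s) \<and> X (Suc t) \<omega> = j} =
    measure M {\<omega> \<in> space M. \<forall>s\<le>t. X s \<omega> = x s} * P $$ (x t, j)" (is "measure M ?B = measure M ?A * _")
    and "{\<omega> \<in> space M. \<forall>s\<le>t. X s \<omega> = x s} \<in> sets M"
    and "{\<omega> \<in> space M. (\<forall>s\<le>t. X s \<omega> = x s) \<and> X (Suc t) \<omega> = j} \<in> sets M"
proof -
  interpret prob_space M using mc by (simp add: markov_chain_def)
  have X: "X t \<in> measurable M (count_space {0..<d})" for t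
    using mc P by (auto simp: markov_chain_def)
  have eq_sets: "{\<omega> \<in> space M. X s \<omega> = i} \<in> sets M" if "i < d" for s i
  proof -
    have "X s -` {i} \<inter> space M \<in> sets M" using that by (intro measurable_sets[OF X]) auto
    moreover have "X s -` {i} \<inter> space M = {\<omega> \<in> space M. X s \<omega> = i}" by auto
    ultimately show ?thesis by simp
  qed
  have A_eq: "?A = {\<omega> \<in> space M. \<forall>s\<in>{..t}. X s \<omega> = x s}" by auto
  show A: "?A \<in> sets M"
    unfolding A_eq using eq_sets[OF x] by (intro sets.sets_Collect_finite_All) auto
  then show "?B \<in> sets M" using eq_sets[OF j, of "Suc t"] by (intro sets.sets_Collect_conj)
  show "measure M ?B = measure M ?A * P $$ (x t, j)"
  proof (cases "measure M ?A > 0")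
    case True
    have "\<P>(\<omega> in M. X (Suc t) \<omega> = j \<bar> \<forall>s\<le>t. X s \<omega> = x s) = P $$ (x t, j)"
      using mc x j True P by (auto simp: markov_chain_def)
    then show ?thesis using True unfolding cond_prob_def by (simp add: field_simps conj_commute)
  next
    case False
    then have "measure M ?A = 0" by (simp add: not_less measure_le_0_iff)
    moreover have "measure M ?B \<le> measure M ?A" by (rule finite_measure_mono[OF _ A]) blast
    ultimately have "measure M ?B = 0" using measure_nonneg[of M ?B] by linarith
    then show ?thesis using \<open>measure M ?A = 0\<close> by (simp only: mult_zero_left)
  qed
qed

text \<open>The Markov property conditions on complete paths, so the event is split into the
  finitely many paths avoiding 0, which are then grouped by their state at time \<open>t\<close>.
  Absorption at 0 lets no mass return to \<open>j > 0\<close>.\<close>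

lemma measure_survives_state:
  assumes mc: "markov_chain M X \<mu> P" and P: "P \<in> carrier_mat d d" and \<mu>: "\<mu> \<in> carrier_vec d"
    and j: "0 < j" "j < d"
  shows "measure M (survives M X t \<inter> {\<omega> \<in> space M. X t \<omega> = j}) = (\<mu> \<^sub>v* absorb0 P ^\<^sub>m t) $ j"
  using j
proof (induction t arbitrary: j)
  case 0
  have "survives M X 0 \<inter> {\<omega> \<in> space M. X 0 \<omega> = j} = {\<omega> \<in> space M. X 0 \<omega> = j}"
    using 0 by (auto simp: survives_def)
  then show ?case using mc P \<mu> 0 by (simp add: markov_chain_def row_mult_def absorb0_def)
next
  case (Suc t)
  interpret prob_space M using mc by (simp add: markov_chain_def)
  have X: "X t \<in> measurable M (count_space {0..<d})" for t
    using mc P by (auto simp: markov_chain_def)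
  have X_lt: "X s \<omega> < d" if "\<omega> \<in> space M" for s \<omega>
    using measurable_space[OF X that] by simp
  define path where "path x = {\<omega> \<in> space M. \<forall>s\<le>t. X s \<omega> = x s}" for x :: "nat \<Rightarrow> nat"
  define step where "step x = {\<omega> \<in> space M. (\<forall>s\<le>t. X s \<omega> = x s) \<and> X (Suc t) \<omega> = j}" for x :: "nat \<Rightarrow> nat"
  \<comment> \<open>Paths through nonzero states that end in \<open>i\<close>. \<open>PiE\<close>
    fixes the values beyond \<open>t\<close>, so a path is determined by its values up to
    \<open>t\<close>.\<close>
  define F where "F i = {x \<in> PiE {..t} (\<lambda>_. {1..<d}). x t = i}" for i
  have fin: "finite (F i)" for i unfolding F_def by (rule finite_subset[OF _ finite_PiE[of "{..t}" "\<lambda>_. {1..<d}"]]) auto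
  have lt: "x s < d" if "x \<in> F i" "s \<le> t" for x i s
    using that by (auto simp: F_def PiE_iff)
  have F_D: "x t = i" "\<And>s. s \<le> t \<Longrightarrow> x s \<noteq> 0" if "x \<in> F i" for x i
    using that by (auto simp: F_def PiE_iff Suc_le_eq)
  have F_eq: "x = y" if "x \<in> F i" "y \<in> F k" "\<And>s. s \<le> t \<Longrightarrow> x s = y s" for x y i k
    using that by (intro PiE_ext[of x "{..t}" _ y]) (auto simp: F_def)
  have path_sets: "path x \<in> sets M" "step x \<in> sets M"
    and path_next: "measure M (step x) = measure M (path x) * P $$ (i, j)" if "x \<in> F i" for x i
  proof -
    have x: "x t = i" using that by (simp add: F_def)
    note * = markov_chain_step[OF mc P lt[OF that] Suc.prems(2)]
    show "path x \<in> sets M" "step x \<in> sets M" unfolding path_def step_def by (rule *, assumption)+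
    show "measure M (step x) = measure M (path x) * P $$ (i, j)"
      unfolding path_def step_def x[symmetric] by (rule *, assumption)
  qed
  have disj: "x = y" if "x \<in> F i" "y \<in> F k" "\<omega> \<in> path x" "\<omega> \<in> path y" for x y i k \<omega>
  proof (rule F_eq[OF that(1,2)])
    fix s assume "s \<le> t"
    then have "X s \<omega> = x s" "X s \<omega> = y s" using that(3,4) by (simp_all add: path_def)
    then show "x s = y s" by simp
  qed
  have step_path: "step x \<subseteq> path x" for x by (auto simp: step_def path_def)
  have disj_path: "disjoint_family_on path (F i)" for i
    unfolding disjoint_family_on_def using disj by blast
  have disj_step: "disjoint_family_on step (\<Union>i\<in>{1..<d}. F i)"
    unfolding disjoint_family_on_def using disj step_path by blast
  have exF: "restrict (\<lambda>s. X s \<omega>) {..t} \<in> F (X t \<omega>)"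
    if "\<omega> \<in> space M" "\<forall>s\<le>t. X s \<omega> \<noteq> 0" for \<omega>
    using that X_lt by (auto simp: F_def Suc_le_eq)
  have pathU: "survives M X t \<inter> {\<omega> \<in> space M. X t \<omega> = i} = (\<Union>x\<in>F i. path x)" for i
  proof (intro equalityI subsetI)
    fix \<omega> assume "\<omega> \<in> survives M X t \<inter> {\<omega> \<in> space M. X t \<omega> = i}"
    then show "\<omega> \<in> (\<Union>x\<in>F i. path x)"
      using exF[of \<omega>] by (auto simp: survives_def path_def intro!: bexI[of _ "restrict (\<lambda>s. X s \<omega>) {..t}"])
  next
    fix \<omega> assume "\<omega> \<in> (\<Union>x\<in>F i. path x)"
    then obtain x where x: "x \<in> F i" "\<omega> \<in> path x" by blast
    then show "\<omega> \<in> survives M X t \<inter> {\<omega> \<in> space M. X t \<omega> = i}"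
      using F_D[OF x(1)] by (auto simp: survives_def path_def)
  qed
  have nextU: "survives M X (Suc t) \<inter> {\<omega> \<in> space M. X (Suc t) \<omega> = j} = (\<Union>x\<in>(\<Union>i\<in>{1..<d}. F i). step x)"
  proof (intro equalityI subsetI)
    fix \<omega> assume "\<omega> \<in> survives M X (Suc t) \<inter> {\<omega> \<in> space M. X (Suc t) \<omega> = j}"
    then have *: "\<omega> \<in> space M" "\<forall>s\<le>t. X s \<omega> \<noteq> 0" "X (Suc t) \<omega> = j" by (auto simp: survives_def)
    let ?x = "restrict (\<lambda>s. X s \<omega>) {..t}"
    have "?x \<in> (\<Union>i\<in>{1..<d}. F i)" using exF[OF *(1,2)] X_lt[OF *(1), of t] *(2) by (auto simp: Suc_le_eq)
    moreover have "\<omega> \<in> step ?x" using * by (auto simp: step_def)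
    ultimately show "\<omega> \<in> (\<Union>x\<in>(\<Union>i\<in>{1..<d}. F i). step x)" by blast
  next
    fix \<omega> assume "\<omega> \<in> (\<Union>x\<in>(\<Union>i\<in>{1..<d}. F i). step x)"
    then obtain x i where x: "x \<in> F i" "\<omega> \<in> step x" by blast
    then show "\<omega> \<in> survives M X (Suc t) \<inter> {\<omega> \<in> space M. X (Suc t) \<omega> = j}"
      using Suc.prems(1) F_D[OF x(1)] by (auto simp: survives_def step_def le_Suc_eq)
  qed
  have "measure M (survives M X (Suc t) \<inter> {\<omega> \<in> space M. X (Suc t) \<omega> = j}) =
      (\<Sum>x\<in>(\<Union>i\<in>{1..<d}. F i). measure M (step x))"
    unfolding nextU by (rule finite_measure_finite_Union[OF _ _ disj_step]) (use fin path_sets in auto)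
  also have "\<dots> = (\<Sum>i\<in>{1..<d}. \<Sum>x\<in>F i. measure M (step x))"
  proof (rule sum.UNION_disjoint)
    show "\<forall>i\<in>{1..<d}. \<forall>k\<in>{1..<d}. i \<noteq> k \<longrightarrow> F i \<inter> F k = {}" by (auto simp: F_def)
  qed (use fin in auto)
  also have "\<dots> = (\<Sum>i\<in>{1..<d}. (\<Sum>x\<in>F i. measure M (path x)) * P $$ (i, j))"
    unfolding sum_distrib_right using path_next by (intro sum.cong) auto
  also have "\<dots> = (\<Sum>i\<in>{1..<d}. measure M (survives M X t \<inter> {\<omega> \<in> space M. X t \<omega> = i}) * P $$ (i, j))"
  proof -
    have "measure M (\<Union>x\<in>F i. path x) = (\<Sum>x\<in>F i. measure M (path x))" for i
      by (rule finite_measure_finite_Union[OF fin _ disj_path]) (use path_sets in auto)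
    then show ?thesis unfolding pathU by simp
  qed
  also have "\<dots> = (\<Sum>i\<in>{1..<d}. (\<mu> \<^sub>v* absorb0 P ^\<^sub>m t) $ i * absorb0 P $$ (i, j))"
    using Suc by (intro sum.cong) (auto simp: absorb0_index[OF P])
  \<comment> \<open>State 0 may be included: row 0 of \<open>absorb0 P\<close> is zero in column
    \<open>j > 0\<close>.\<close>
  also have "\<dots> = (\<Sum>i<d. (\<mu> \<^sub>v* absorb0 P ^\<^sub>m t) $ i * absorb0 P $$ (i, j))"
    using Suc.prems by (intro sum.mono_neutral_left) (auto simp: absorb0_index[OF P])
  also have "\<dots> = (\<mu> \<^sub>v* absorb0 P ^\<^sub>m Suc t) $ j"
    using row_mult_index[OF row_mult_carrier absorb0_carrier[OF P] Suc.prems(2), of "absorb0 P ^\<^sub>m t" d \<mu>]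
      row_mult_assoc[OF \<mu> pow_carrier_mat[OF absorb0_carrier[OF P]] absorb0_carrier[OF P]]
      pow_carrier_mat[OF absorb0_carrier[OF P]] by simp
  finally show ?case .
qed

lemma measure_survives:
  assumes mc: "markov_chain M X \<mu> P" and P: "P \<in> carrier_mat d d" and \<mu>: "\<mu> \<in> carrier_vec d"
  shows "measure M (survives M X t) = (\<Sum>j=1..<d. (\<mu> \<^sub>v* absorb0 P ^\<^sub>m t) $ j)"
proof -
  interpret prob_space M using mc by (simp add: markov_chain_def)
  have X: "X t \<in> measurable M (count_space {0..<d})" for t
    using mc P by (auto simp: markov_chain_def)
  let ?E = "\<lambda>j. survives M X t \<inter> {\<omega> \<in> space M. X t \<omega> = j}"
  have E: "?E j \<in> sets M" if "j < d" for j
  proof -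
    have "X t -` {j} \<inter> space M \<in> sets M" using that by (intro measurable_sets[OF X]) auto
    moreover have "?E j = survives M X t \<inter> (X t -` {j} \<inter> space M)" by auto
    ultimately show ?thesis using survives_sets[where X = X, OF X] by simp
  qed
  have "survives M X t = (\<Union>j\<in>{1..<d}. ?E j)"
    using measurable_space[OF X] by (fastforce simp: survives_def Suc_le_eq)
  then have "measure M (survives M X t) = measure M (\<Union>j\<in>{1..<d}. ?E j)" by simp
  also have "\<dots> = (\<Sum>j=1..<d. measure M (?E j))"
    using E by (intro finite_measure_finite_Union) (auto simp: disjoint_family_on_def)
  also have "\<dots> = (\<Sum>j=1..<d. (\<mu> \<^sub>v* absorb0 P ^\<^sub>m t) $ j)"
    using measure_survives_state[OF mc P \<mu>] by (intro sum.cong) auto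
  finally show ?thesis .
qed

section \<open>The intertwining\<close>

lemma quasi_link_mult:
  assumes A: "A \<in> carrier_mat m k" and B: "B \<in> carrier_mat k l" and "quasi_link A" "quasi_link B"
  shows "quasi_link (A * B)"
proof -
  have "(\<Sum>j<l. (A * B) $$ (i, j)) = 1" if i: "i < m" for i
  proof -
    have "(\<Sum>j<l. (A * B) $$ (i, j)) = (\<Sum>j<l. \<Sum>h<k. A $$ (i, h) * B $$ (h, j))"
      by (intro sum.cong refl index_mult_mat_sum[OF A B i]) simp
    also have "\<dots> = (\<Sum>h<k. A $$ (i, h) * (\<Sum>j<l. B $$ (h, j)))"
      unfolding sum_distrib_left by (rule sum.swap)
    also have "\<dots> = 1" using assms i by (simp add: quasi_link_def)
    finally show ?thesis .
  qed
  then show ?thesis using A B by (simp add: quasi_link_def)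
qed

text \<open>Row sums determine column 0 from the others, so intertwining relations need checking
  only off column 0.\<close>

lemma quasi_link_eqI:
  assumes A: "A \<in> carrier_mat m (Suc k)" "quasi_link A" and B: "B \<in> carrier_mat m (Suc k)" "quasi_link B"
    and eq: "\<And>i j. i < m \<Longrightarrow> j < k \<Longrightarrow> A $$ (i, Suc j) = B $$ (i, Suc j)"
  shows "A = B"
proof (rule eq_matI)
  fix i j assume "i < dim_row B" "j < dim_col B"
  then have ij: "i < m" "j < Suc k" using B by auto
  have "A $$ (i, 0) = 1 - (\<Sum>j<k. A $$ (i, Suc j))" "B $$ (i, 0) = 1 - (\<Sum>j<k. B $$ (i, Suc j))"
    using A B ij(1) unfolding quasi_link_def by (auto simp: sum.lessThan_Suc_shift simp del: sum.lessThan_Suc)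
  then show "A $$ (i, j) = B $$ (i, j)" using eq ij by (cases j) auto
qed (use A B in auto)

section \<open>The dual chain\<close>

lemma pi_hat_carrier: "pi_hat P k \<in> carrier_vec (Suc (red_rank P))"
  by (simp add: pi_hat_def)

lemma pi_hat_0: "j \<le> red_rank P \<Longrightarrow> pi_hat P 0 $ j = (if j = 0 then 1 else 0)"
  by (simp add: pi_hat_def)

text \<open>Each vector mixes the previous one, with weight \<open>rho P (Suc k)\<close>, and the
  point mass at the new index. The inductions below run on this recursion.\<close>

lemma pi_hat_Suc:
  "j \<le> red_rank P \<Longrightarrow> pi_hat P (Suc k) $ j =
    rho P (Suc k) * pi_hat P k $ j + (if j = Suc k then 1 - rho P (Suc k) else 0)"
  by (auto simp: pi_hat_def le_Suc_eq not_le)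

lemma pi_hat_eq_0: "k < j \<Longrightarrow> j \<le> red_rank P \<Longrightarrow> pi_hat P k $ j = 0"
  by (simp add: pi_hat_def)

lemma pi_hat_sum: "k \<le> red_rank P \<Longrightarrow> (\<Sum>j<Suc (red_rank P). pi_hat P k $ j) = 1"
proof (induction k)
  case 0
  then show ?case by (simp add: pi_hat_0 less_Suc_eq_le sum.If_cases[symmetric] sum.lessThan_Suc_shift del: sum.lessThan_Suc)
next
  case (Suc k)
  have "(\<Sum>j<Suc (red_rank P). pi_hat P (Suc k) $ j) =
      rho P (Suc k) * (\<Sum>j<Suc (red_rank P). pi_hat P k $ j)
      + (\<Sum>j<Suc (red_rank P). if j = Suc k then 1 - rho P (Suc k) else 0)"
    unfolding sum_distrib_left sum.distrib[symmetric] by (intro sum.cong) (auto simp: pi_hat_Suc)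
  then show ?case using Suc by (simp del: sum.lessThan_Suc)
qed

lemma P_hat_carrier: "P_hat P \<in> carrier_mat (Suc (red_rank P)) (Suc (red_rank P))"
  by (simp add: P_hat_def)

text \<open>Row \<open>i\<close> is \<open>gam P i\<close> times the point mass at \<open>i\<close>
  plus \<open>1 - gam P i\<close> times \<open>pi_hat P (i - 1)\<close>; the latter vanishes from
  index \<open>i\<close> on, so the case distinction in \<open>P_hat\<close> disappears.\<close>

lemma P_hat_mult_sum:
  fixes f :: "nat \<Rightarrow> real"
  assumes i: "0 < i" "i \<le> red_rank P"
  shows "(\<Sum>h<Suc (red_rank P). P_hat P $$ (i, h) * f h) =
    gam P i * f i + (1 - gam P i) * (\<Sum>h<Suc (red_rank P). pi_hat P (i - 1) $ h * f h)"
proof -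
  have "(\<Sum>h<Suc (red_rank P). P_hat P $$ (i, h) * f h) =
      (\<Sum>h<Suc (red_rank P). (if h = i then gam P i * f h else 0) +
        (1 - gam P i) * (pi_hat P (i - 1) $ h * f h))"
    using i by (intro sum.cong refl) (auto simp: P_hat_def pi_hat_eq_0 not_less)
  then show ?thesis using i by (simp add: sum.distrib sum_distrib_left del: sum.lessThan_Suc)
qed

lemma P_hat_row0: "h \<le> red_rank P \<Longrightarrow> P_hat P $$ (0, h) = (if h = 0 then 1 else 0)"
  by (simp add: P_hat_def)

lemma P_hat_quasi_link: "quasi_link (P_hat P)"
proof -
  have "(\<Sum>h<Suc (red_rank P). P_hat P $$ (i, h)) = 1" if "i \<le> red_rank P" for i
  proof (cases "i = 0")
    case True
    have "(\<Sum>h<Suc (red_rank P). P_hat P $$ (0, h)) = (\<Sum>h<Suc (red_rank P). if h = 0 then 1 else 0)"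
      by (intro sum.cong) (auto simp: P_hat_row0)
    then show ?thesis using True by simp
  next
    case False
    then show ?thesis
      using P_hat_mult_sum[of i P "\<lambda>_. 1"] pi_hat_sum[of "i - 1" P] that by simp
  qed
  then show ?thesis using carrier_matD[OF P_hat_carrier[of P]] by (simp add: quasi_link_def less_Suc_eq_le)
qed

text \<open>State 0 is already absorbing, so \<open>measure_survives\<close> gives powers of
  \<open>P_hat P\<close> itself.\<close>

lemma absorb0_P_hat: "absorb0 (P_hat P) = P_hat P"
  using P_hat_carrier[of P] P_hat_row0[of _ P] by (intro eq_matI) (auto simp: absorb0_def)

lemma absorb0_quasi_link:
  assumes P: "P \<in> carrier_mat (Suc n) (Suc n)" and st: "stochastic_mat P"
  shows "quasi_link (absorb0 P)"
proof -
  have "(\<Sum>j<Suc n. absorb0 P $$ (i, j)) = 1" if "i < Suc n" for i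
  proof (cases "i = 0")
    case True
    have "(\<Sum>j<Suc n. absorb0 P $$ (0, j)) = (\<Sum>j<Suc n. if j = 0 then 1 else 0)"
      by (intro sum.cong) (auto simp: absorb0_index[OF P])
    then show ?thesis using True by simp
  next
    case False
    then have "(\<Sum>j<Suc n. absorb0 P $$ (i, j)) = (\<Sum>j<Suc n. P $$ (i, j))"
      using that by (intro sum.cong) (auto simp: absorb0_index[OF P])
    then show ?thesis using st P that by (simp add: stochastic_mat_def del: sum.lessThan_Suc)
  qed
  then show ?thesis using carrier_matD[OF absorb0_carrier[OF P]] by (simp add: quasi_link_def)
qed

section \<open>The matrix \<open>Lambda2\<close> and the star-shaped chain\<close>

lemma Lambda2_carrier: "Lambda2 P \<in> carrier_mat (Suc (red_rank P)) (Suc (red_rank P))"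
  by (simp add: Lambda2_def)

lemma Lambda2_row0: "j \<le> red_rank P \<Longrightarrow> Lambda2 P $$ (0, j) = (if j = 0 then 1 else 0)"
  by (simp add: Lambda2_def)

lemma Lambda2_index:
  "0 < i \<Longrightarrow> i \<le> red_rank P \<Longrightarrow> j \<le> red_rank P \<Longrightarrow>
    Lambda2 P $$ (i, j) = (pi_star P i $ j - rho P i * pi_star P (i - 1) $ j) / (1 - rho P i)"
  by (simp add: Lambda2_def nu_def pi_star_def)

lemma pi_star_0: "j \<le> red_rank P \<Longrightarrow> pi_star P 0 $ j = (if j = 0 then 1 else 0)"
  by (simp add: pi_star_def)

text \<open>The intermediate matrix through which the link factors: \<open>Lambda1\<close> relates
  it to \<open>absorb0 P\<close>, and \<open>Lambda2\<close> relates it to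
  \<open>P_hat P\<close>.\<close>

definition P_star :: "real mat \<Rightarrow> real mat" where
  "P_star P = Matrix.mat (red_rank P + 1) (red_rank P + 1) (\<lambda>(i, j).
     if i = j then (if i = 0 then 1 else gam P i) else if j = 0 then 1 - gam P i else 0)"

lemma P_star_carrier: "P_star P \<in> carrier_mat (Suc (red_rank P)) (Suc (red_rank P))"
  by (simp add: P_star_def)

lemma P_star_index_Suc:
  "i \<le> red_rank P \<Longrightarrow> j < red_rank P \<Longrightarrow> P_star P $$ (i, Suc j) = (if i = Suc j then gam P i else 0)"
  by (simp add: P_star_def)

lemma P_star_quasi_link: "quasi_link (P_star P)"
proof -
  have "(\<Sum>j<Suc (red_rank P). P_star P $$ (i, j)) = 1" if i: "i \<le> red_rank P" for i
  proof -
    have "(\<Sum>j<Suc (red_rank P). P_star P $$ (i, j)) =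
        (\<Sum>j<Suc (red_rank P). (if j = 0 then (if i = 0 then 1 else 1 - gam P i) else 0) +
          (if j = i then (if i = 0 then 0 else gam P i) else 0))"
      using i by (intro sum.cong) (auto simp: P_star_def)
    then show ?thesis using i by (simp add: sum.distrib del: sum.lessThan_Suc)
  qed
  then show ?thesis using carrier_matD[OF P_star_carrier[of P]] by (simp add: quasi_link_def less_Suc_eq_le)
qed

context stationary_decomposition
begin

text \<open>This is \<open>partial_fraction_expansion\<close> for
  \<open>a i = 1 - \<gamma> i\<close> at \<open>y = 0\<close>, where every factor of the product is
  1.\<close>

lemma pi_star_sum:
  assumes k: "k \<le> r"
  shows "(\<Sum>i<Suc r. pi_star P k $ i) = 1"
proof -
  have inj: "inj_on (\<lambda>i. 1 - \<gamma> i) {1..k}"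
  proof (rule inj_onI)
    fix i j assume "i \<in> {1..k}" "j \<in> {1..k}" "1 - \<gamma> i = 1 - \<gamma> j"
    then have "\<gamma> i = \<gamma> j" "i \<in> {1..r}" "j \<in> {1..r}" using k by auto
    then show "i = j" by (rule inj_onD[OF inj_gam])
  qed
  have ne: "1 - \<gamma> i \<noteq> 0" if "i \<in> {1..k}" for i using gam_ne_1[of i] that k by auto
  have "(\<Sum>i<Suc r. pi_star P k $ i) = (\<Sum>i\<in>insert 0 {1..k}. pi_star P k $ i)"
    using k by (intro sum.mono_neutral_right) (auto simp: pi_star_def)
  also have "\<dots> = (\<Prod>j=1..k. rho P j) + (\<Sum>i=1..k. pi_star P k $ i)"
    by (simp add: pi_star_def)
  also have "(\<Sum>i=1..k. pi_star P k $ i) =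
      (\<Sum>i=1..k. (1 - \<gamma> i) * ((1 - rho P i) * (\<Prod>j\<in>{1..k} - {i}.
        (1 - \<gamma> j - rho P j * (1 - \<gamma> i)) / (1 - \<gamma> j - (1 - \<gamma> i)))) / (1 - \<gamma> i - 0))"
    using ne k by (intro sum.cong refl) (simp add: pi_star_def)
  also have "(\<Prod>j=1..k. rho P j) + \<dots> = (\<Prod>j=1..k. (1 - \<gamma> j - rho P j * 0) / (1 - \<gamma> j - 0))"
    using partial_fraction_expansion[OF inj, of 0 "rho P"] ne by simp
  also have "\<dots> = 1" using ne by (intro prod.neutral) auto
  finally show ?thesis .
qed

lemma Lambda2_quasi_link: "quasi_link (Lambda2 P)"
proof -
  have "(\<Sum>j<Suc r. Lambda2 P $$ (i, j)) = 1" if i: "i \<le> r" for i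
  proof (cases "i = 0")
    case True
    have "(\<Sum>j<Suc r. Lambda2 P $$ (0, j)) = (\<Sum>j<Suc r. if j = 0 then 1 else 0)"
      by (intro sum.cong) (auto simp: Lambda2_row0)
    then show ?thesis using True by simp
  next
    case False
    then have "(\<Sum>j<Suc r. Lambda2 P $$ (i, j)) =
        ((\<Sum>j<Suc r. pi_star P i $ j) - rho P i * (\<Sum>j<Suc r. pi_star P (i - 1) $ j)) / (1 - rho P i)"
      using i by (simp add: Lambda2_index sum_divide_distrib sum_subtractf sum_distrib_left
        diff_divide_distrib less_Suc_eq_le del: sum.lessThan_Suc)
    then show ?thesis using pi_star_sum[OF i] pi_star_sum[of "i - 1"] rho_ne_1[of i] False i
      by (simp del: sum.lessThan_Suc)
  qed
  then show ?thesis using carrier_matD[OF Lambda2_carrier[of P]] by (simp add: quasi_link_def less_Suc_eq_le)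
qed

text \<open>The entry of \<open>pi_star P i\<close> at 0 is \<open>rho P i\<close> times that of
  \<open>pi_star P (i - 1)\<close>, so the difference in \<open>nu\<close> cancels there.\<close>

lemma Lambda2_col0: "i \<le> r \<Longrightarrow> Lambda2 P $$ (i, 0) = (if i = 0 then 1 else 0)"
proof (cases "i = 0")
  case False
  assume "i \<le> r"
  moreover obtain k where "i = Suc k" using False by (cases i) auto
  ultimately show ?thesis by (simp add: Lambda2_index pi_star_def)
qed (simp add: Lambda2_row0)

text \<open>\<open>nu\<close> is the vector that makes \<open>pi_star P k\<close> the mixture of
  \<open>pi_star P (k - 1)\<close> and \<open>nu P k\<close> with the weights of
  \<open>pi_hat_Suc\<close>; both sides thus obey one recursion.\<close>

lemma pi_hat_Lambda2:
  "k \<le> r \<Longrightarrow> j \<le> r \<Longrightarrow> (\<Sum>h<Suc r. pi_hat P k $ h * Lambda2 P $$ (h, j)) = pi_star P k $ j"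
proof (induction k)
  case 0
  have "(\<Sum>h<Suc r. pi_hat P 0 $ h * Lambda2 P $$ (h, j)) =
      (\<Sum>h<Suc r. if h = 0 then Lambda2 P $$ (h, j) else 0)"
    by (intro sum.cong) (auto simp: pi_hat_0)
  then show ?case using 0 by (simp add: Lambda2_row0 pi_star_0)
next
  case (Suc k)
  have "(\<Sum>h<Suc r. pi_hat P (Suc k) $ h * Lambda2 P $$ (h, j)) =
      rho P (Suc k) * (\<Sum>h<Suc r. pi_hat P k $ h * Lambda2 P $$ (h, j)) +
      (\<Sum>h<Suc r. if h = Suc k then (1 - rho P (Suc k)) * Lambda2 P $$ (h, j) else 0)"
    unfolding sum_distrib_left sum.distrib[symmetric]
    by (intro sum.cong) (auto simp: pi_hat_Suc algebra_simps)
  also have "\<dots> = rho P (Suc k) * pi_star P k $ j + (1 - rho P (Suc k)) * Lambda2 P $$ (Suc k, j)"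
    using Suc by (simp del: sum.lessThan_Suc)
  also have "\<dots> = pi_star P (Suc k) $ j"
    using rho_ne_1[of "Suc k"] Suc.prems by (simp add: Lambda2_index)
  finally show ?case .
qed

text \<open>By \<open>pi_hat_Lambda2\<close>, row \<open>i > 0\<close> of the right side is
  \<open>\<gamma> i\<close> times row \<open>i\<close> of \<open>Lambda2 P\<close> plus
  \<open>1 - \<gamma> i\<close> times \<open>pi_star P (i - 1)\<close>. Off column 0
  \<open>P_star\<close> is diagonal, so a scalar relation remains for each entry.\<close>

lemma Lambda2_intertwines: "Lambda2 P * P_star P = P_hat P * Lambda2 P"
proof (rule quasi_link_eqI)
  fix i l assume il: "i < Suc r" "l < r"
  have "(Lambda2 P * P_star P) $$ (i, Suc l) =
      (\<Sum>h<Suc r. if h = Suc l then Lambda2 P $$ (i, h) * \<gamma> h else 0)"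
    unfolding index_mult_mat_sum[OF Lambda2_carrier P_star_carrier il(1) Suc_mono[OF il(2)]]
    using il by (intro sum.cong) (auto simp: P_star_index_Suc)
  also have "\<dots> = Lambda2 P $$ (i, Suc l) * \<gamma> (Suc l)"
    using il by (simp del: sum.lessThan_Suc)
  finally have lhs: "(Lambda2 P * P_star P) $$ (i, Suc l) = Lambda2 P $$ (i, Suc l) * \<gamma> (Suc l)" .
  have rhs: "(P_hat P * Lambda2 P) $$ (i, Suc l) =
      (\<Sum>h<Suc r. P_hat P $$ (i, h) * Lambda2 P $$ (h, Suc l))"
    by (rule index_mult_mat_sum[OF P_hat_carrier Lambda2_carrier il(1) Suc_mono[OF il(2)]])
  show "(Lambda2 P * P_star P) $$ (i, Suc l) = (P_hat P * Lambda2 P) $$ (i, Suc l)"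
  proof (cases "i = 0")
    case True
    have "(\<Sum>h<Suc r. P_hat P $$ (0, h) * Lambda2 P $$ (h, Suc l)) =
        (\<Sum>h<Suc r. if h = 0 then Lambda2 P $$ (h, Suc l) else 0)"
      by (intro sum.cong) (auto simp: P_hat_row0)
    then show ?thesis using il True unfolding lhs rhs by (simp add: Lambda2_row0)
  next
    case False
    then obtain k where k: "i = Suc k" by (cases i) auto
    have R: "(P_hat P * Lambda2 P) $$ (i, Suc l) =
        \<gamma> i * Lambda2 P $$ (i, Suc l) + (1 - \<gamma> i) * pi_star P k $ Suc l"
      unfolding rhs using P_hat_mult_sum[of i P "\<lambda>h. Lambda2 P $$ (h, Suc l)"]
        pi_hat_Lambda2[of k "Suc l"] il k by simp
    define x where "x = pi_star P k $ Suc l"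
    have i1: "i \<in> {1..r}" using il k by auto
    have ne: "1 - rho P i \<noteq> 0" using rho_ne_1[OF i1] by simp
    \<comment> \<open>Below \<open>i\<close>, passing from \<open>k\<close> to \<open>i\<close> adds
      one factor to the product in \<open>pi_star\<close>. At \<open>i\<close> both sides vanish, as
      \<open>pi_star P k\<close> is 0 there; beyond \<open>i\<close> all entries are 0.\<close>
    have key: "(\<gamma> (Suc l) - \<gamma> i) * (pi_star P i $ Suc l - rho P i * x) = (1 - rho P i) * (1 - \<gamma> i) * x"
    proof -
      consider "Suc l < i" | "Suc l = i" | "i < Suc l" by linarith
      then show ?thesis
      proof cases
        case 1
        have \<gamma>: "\<gamma> (Suc l) - \<gamma> i \<noteq> 0"
          using inj_onD[OF inj_gam, of "Suc l" i] 1 i1 il by auto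
        have "{1..i} - {Suc l} = insert i ({1..k} - {Suc l})" using 1 k by auto
        then have "pi_star P i $ Suc l = x * ((1 - \<gamma> i - rho P i * (1 - \<gamma> (Suc l))) / (\<gamma> (Suc l) - \<gamma> i))"
          unfolding x_def using 1 k il by (simp add: pi_star_def)
        then have "(\<gamma> (Suc l) - \<gamma> i) * pi_star P i $ Suc l = x * (1 - \<gamma> i - rho P i * (1 - \<gamma> (Suc l)))"
          using \<gamma> by simp
        then show ?thesis by (simp add: algebra_simps)
      next
        case 2
        then show ?thesis using k il by (simp add: x_def pi_star_def)
      next
        case 3
        then show ?thesis using k il by (simp add: x_def pi_star_def)
      qed
    qed
    have \<nu>: "Lambda2 P $$ (i, Suc l) = (pi_star P i $ Suc l - rho P i * x) / (1 - rho P i)"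
      using il k by (simp add: Lambda2_index x_def)
    have "Lambda2 P $$ (i, Suc l) * \<gamma> (Suc l) - \<gamma> i * Lambda2 P $$ (i, Suc l) =
        (\<gamma> (Suc l) - \<gamma> i) * Lambda2 P $$ (i, Suc l)"
      by (simp add: algebra_simps)
    also have "\<dots> = (\<gamma> (Suc l) - \<gamma> i) * (pi_star P i $ Suc l - rho P i * x) / (1 - rho P i)"
      unfolding \<nu> by simp
    also have "\<dots> = (1 - \<gamma> i) * x" unfolding key using ne by simp
    finally show ?thesis unfolding lhs R x_def by simp
  qed
qed (auto intro!: quasi_link_mult[of _ "Suc r" "Suc r" _ "Suc r"] mult_carrier_mat[of _ _ "Suc r"]
  Lambda2_carrier P_star_carrier P_hat_carrier Lambda2_quasi_link P_star_quasi_link P_hat_quasi_link)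

lemma L_quasi_link: "quasi_link L"
  using L L_sum by (simp add: quasi_link_def)

text \<open>Off column 0 this is the eigenvector relation \<open>L_eig\<close>, and row 0 of
  \<open>L\<close> vanishes there.\<close>

lemma L_intertwines: "L * absorb0 P = P_star P * L"
proof (rule quasi_link_eqI)
  note abs = absorb0_carrier[OF P]
  show "L * absorb0 P \<in> carrier_mat (Suc r) (Suc n)" "P_star P * L \<in> carrier_mat (Suc r) (Suc n)"
    using L abs P_star_carrier by (auto intro: mult_carrier_mat)
  show "quasi_link (L * absorb0 P)" "quasi_link (P_star P * L)"
    using L abs P_star_carrier L_quasi_link P_star_quasi_link absorb0_quasi_link[OF P stochastic]
    by (auto intro: quasi_link_mult)
  fix i l assume il: "i < Suc r" "l < n"
  have lhs: "(L * absorb0 P) $$ (i, Suc l) = (\<Sum>k<n. L $$ (i, Suc k) * P $$ (Suc k, Suc l))"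
    unfolding index_mult_mat_sum[OF L abs il(1) Suc_mono[OF il(2)]] sum.lessThan_Suc_shift
    using il by (simp add: absorb0_index[OF P])
  have rhs: "(P_star P * L) $$ (i, Suc l) = P_star P $$ (i, i) * L $$ (i, Suc l)"
  proof -
    have "(P_star P * L) $$ (i, Suc l) =
        (\<Sum>h<Suc r. if h = i then P_star P $$ (i, h) * L $$ (h, Suc l) else 0)"
      unfolding index_mult_mat_sum[OF P_star_carrier L il(1) Suc_mono[OF il(2)]]
      using il L_row0[of "Suc l"] by (intro sum.cong) (auto simp: P_star_def)
    then show ?thesis using il by (simp del: sum.lessThan_Suc)
  qed
  show "(L * absorb0 P) $$ (i, Suc l) = (P_star P * L) $$ (i, Suc l)"
  proof (cases "i = 0")
    case True
    then show ?thesis using L_row0 il unfolding lhs rhs by simp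
  next
    case False
    then show ?thesis using L_eig[of i l] il unfolding lhs rhs by (simp add: P_star_def)
  qed
qed

section \<open>The composed link\<close>

definition Lam :: "real mat" where
  "Lam = Lambda2 P * L"

lemma Lam_carrier: "Lam \<in> carrier_mat (Suc r) (Suc n)"
  unfolding Lam_def using Lambda2_carrier L by (rule mult_carrier_mat)

lemma Lam_quasi_link: "quasi_link Lam"
  unfolding Lam_def using Lambda2_carrier L Lambda2_quasi_link L_quasi_link by (rule quasi_link_mult)

lemma Lam_intertwines: "Lam * absorb0 P = P_hat P * Lam"
proof -
  note c = Lambda2_carrier[of P] L absorb0_carrier[OF P] P_star_carrier[of P] P_hat_carrier[of P]
  have "Lam * absorb0 P = Lambda2 P * (P_star P * L)"
    unfolding Lam_def assoc_mult_mat[OF c(1) c(2) c(3)] L_intertwines ..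
  also have "\<dots> = P_hat P * Lam"
    unfolding Lam_def assoc_mult_mat[OF c(1) c(4) c(2), symmetric] Lambda2_intertwines
    by (rule assoc_mult_mat[OF c(5) c(1) c(2)])
  finally show ?thesis .
qed

lemma pi_hat_Lam: "pi_hat P r \<^sub>v* Lam = \<pi>"
proof -
  have "pi_hat P r \<^sub>v* Lambda2 P = s"
  proof (rule eq_vecI)
    fix j assume "j < dim_vec s"
    then have j: "j < Suc r" using carrier_vecD[OF s_carrier[of r]] by simp
    then show "(pi_hat P r \<^sub>v* Lambda2 P) $ j = s $ j"
      using row_mult_index[OF pi_hat_carrier Lambda2_carrier j] pi_hat_Lambda2[of r j] by simp
  qed (use carrier_vecD[OF s_carrier[of r]] carrier_vecD[OF row_mult_carrier[OF Lambda2_carrier]] in auto)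
  then show ?thesis
    unfolding Lam_def row_mult_assoc[OF pi_hat_carrier Lambda2_carrier L, symmetric] using \<pi>_eq by simp
qed

text \<open>By \<open>L_col0\<close>, multiplication by \<open>L\<close> leaves column 0 of
  \<open>Lambda2 P\<close> unchanged.\<close>

lemma Lam_col0:
  assumes i: "i < Suc r"
  shows "Lam $$ (i, 0) = (if i = 0 then 1 else 0)"
proof -
  have "Lam $$ (i, 0) = (\<Sum>h<Suc r. if h = 0 then Lambda2 P $$ (i, h) else 0)"
    unfolding Lam_def index_mult_mat_sum[OF Lambda2_carrier L i zero_less_Suc]
    by (intro sum.cong) (auto simp: L_col0)
  then show ?thesis using i by (simp add: Lambda2_col0)
qed

text \<open>The intertwining passes to powers by induction, and \<pi> is \<open>pi_hat P r\<close>
  times \<open>Lam\<close>.\<close>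

lemma evolution_eq:
  "\<pi> \<^sub>v* absorb0 P ^\<^sub>m t = pi_hat P r \<^sub>v* P_hat P ^\<^sub>m t \<^sub>v* Lam"
proof -
  have abs: "absorb0 P ^\<^sub>m t \<in> carrier_mat (Suc n) (Suc n)" for t
    using absorb0_carrier[OF P] by (rule pow_carrier_mat)
  have hat: "P_hat P ^\<^sub>m t \<in> carrier_mat (Suc r) (Suc r)" for t
    using P_hat_carrier by (rule pow_carrier_mat)
  have "Lam * absorb0 P ^\<^sub>m t = P_hat P ^\<^sub>m t * Lam"
  proof (induction t)
    case 0
    then show ?case
      using Lam_carrier carrier_matD[OF absorb0_carrier[OF P]] carrier_matD[OF P_hat_carrier[of P]] by simp
  next
    case (Suc t)
    have "Lam * absorb0 P ^\<^sub>m Suc t = Lam * absorb0 P ^\<^sub>m t * absorb0 P"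
      using assoc_mult_mat[OF Lam_carrier abs[of t] absorb0_carrier[OF P]] by simp
    also have "\<dots> = P_hat P ^\<^sub>m t * (Lam * absorb0 P)"
      unfolding Suc by (rule assoc_mult_mat[OF hat Lam_carrier absorb0_carrier[OF P]])
    also have "\<dots> = P_hat P ^\<^sub>m Suc t * Lam"
      unfolding Lam_intertwines using assoc_mult_mat[OF hat[of t] P_hat_carrier Lam_carrier] by simp
    finally show ?case .
  qed
  then show ?thesis
    unfolding row_mult_assoc[OF pi_hat_carrier hat Lam_carrier]
    using row_mult_assoc[OF pi_hat_carrier Lam_carrier abs] pi_hat_Lam by metis
qed

text \<open>Column 0 of \<open>Lam\<close> is a unit vector and its rows sum to 1, so the link preserves both the total
  mass and the mass absorbed at 0.\<close>

lemma surviving_mass_eq: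
  "(\<Sum>j=1..<Suc n. (\<pi> \<^sub>v* absorb0 P ^\<^sub>m t) $ j) = (\<Sum>j=1..<Suc r. (pi_hat P r \<^sub>v* P_hat P ^\<^sub>m t) $ j)"
proof -
  define v where "v = pi_hat P r \<^sub>v* P_hat P ^\<^sub>m t"
  have v: "v \<in> carrier_vec (Suc r)"
    unfolding v_def by (rule row_mult_carrier[OF pow_carrier_mat[OF P_hat_carrier]])
  have col: "(v \<^sub>v* Lam) $ l = (\<Sum>i<Suc r. v $ i * Lam $$ (i, l))" if "l < Suc n" for l
    by (rule row_mult_index[OF v Lam_carrier that])
  have split: "(\<Sum>j=1..<Suc m. f j) = (\<Sum>j<Suc m. f j) - f 0" for m and f :: "nat \<Rightarrow> real"
    by (simp add: lessThan_atLeast0 sum.atLeast_Suc_lessThan[of 0 "Suc m"] del: sum.op_ivl_Suc)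
  have "(v \<^sub>v* Lam) $ 0 = (\<Sum>i<Suc r. if i = 0 then v $ i else 0)"
    unfolding col[OF zero_less_Suc] by (intro sum.cong) (auto simp: Lam_col0)
  then have absorbed: "(v \<^sub>v* Lam) $ 0 = v $ 0" by simp
  have "(\<Sum>l<Suc n. (v \<^sub>v* Lam) $ l) = (\<Sum>l<Suc n. \<Sum>i<Suc r. v $ i * Lam $$ (i, l))"
    using col by (intro sum.cong) auto
  also have "\<dots> = (\<Sum>i<Suc r. v $ i * (\<Sum>l<Suc n. Lam $$ (i, l)))"
    unfolding sum_distrib_left by (rule sum.swap)
  also have "\<dots> = (\<Sum>i<Suc r. v $ i)"
    using Lam_quasi_link Lam_carrier by (intro sum.cong) (auto simp: quasi_link_def)
  finally show ?thesis unfolding evolution_eq v_def[symmetric] split using absorbed by simp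
qed

end

text \<open>Off state 0, row \<open>i > 0\<close> of \<open>Lambda1\<close> is a combination
  \<open>w i\<close> of left eigenvectors for \<open>gam P i\<close>, hence satisfies the same
  eigenvector equation. \<open>ext_row\<close> puts minus the mass of each eigenvector into column
  0, so rows keep the mass 1 of the unit vector.\<close>

lemma Lambda1_decomposition:
  assumes P: "P \<in> carrier_mat (Suc n) (Suc n)" and st: "stochastic_mat P" and irr: "irreducible_mat P"
    and stat: "stationary \<pi> P" and rev: "time_reversible \<pi> P"
    and V: "orthonormal_left_eigenbasis \<pi> P V"
    and \<pi>: "\<pi> = pi_star P (red_rank P) \<^sub>v* Lambda1 P (U_mat \<pi> V) c"
  shows "stationary_decomposition n P (Lambda1 P (U_mat \<pi> V) c) \<pi>"
proof -
  define U where "U = U_mat \<pi> V"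
  define r where "r = red_rank P"
  define w where "w i l = (\<Sum>j=1..gam_mult P i. c i j * u_row P U i j $ l)" for i l
  have pos: "\<pi> $ i > 0" if "i < Suc n" for i by (rule stationary_pos[OF P st irr stat that])
  have \<pi>c: "\<pi> \<in> carrier_vec (Suc n)" using stat P by (simp add: stationary_def)
  obtain x where cp: "char_poly (del0 P) = (\<Prod>k<n. [:- x k, 1:])"
    using eigenbasis_diagonalizes_del0[OF P \<pi>c pos V] by metis
  note em = eig_mset_linear_factors[OF cp]
  have u: "dim_vec (u_row P U i j) = n"
    "\<And>l. l < n \<Longrightarrow> (\<Sum>k<n. u_row P U i j $ k * P $$ (Suc k, Suc l)) = gam P i * u_row P U i j $ l"
    if "j \<in> {1..gam_mult P i}" for i j
    using left_eigenvector_del0[OF P u_row_left_eigenvector[OF P \<pi>c pos V that]] by (auto simp: U_def)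
  have ext: "ext_row v $ 0 = - (\<Sum>l<n. v $ l)" "\<And>l. l < n \<Longrightarrow> ext_row v $ Suc l = v $ l"
    if "dim_vec v = n" for v
    using that by (auto simp: ext_row_def scalar_prod_def lessThan_atLeast0)
  have idx_Suc: "Lambda1 P U c $$ (i, Suc l) = (if i = 0 then 0 else w i l)" if "i < Suc r" "l < n" for i l
    using that P u(1) ext(2) by (auto simp: Lambda1_def r_def w_def intro!: sum.cong)
  have idx_0: "Lambda1 P U c $$ (i, 0) = (if i = 0 then 1 else 1 - (\<Sum>l<n. w i l))" if "i < Suc r" for i
  proof -
    have "(\<Sum>j=1..gam_mult P i. c i j * ext_row (u_row P U i j) $ 0) =
        (\<Sum>j=1..gam_mult P i. - (\<Sum>l<n. c i j * u_row P U i j $ l))"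
      using u(1) ext(1) by (intro sum.cong) (auto simp: sum_distrib_left)
    also have "\<dots> = - (\<Sum>l<n. w i l)"
      unfolding w_def sum_negf by (subst sum.swap) (rule refl)
    finally show ?thesis using that P by (auto simp: Lambda1_def r_def)
  qed
  have eig: "(\<Sum>k<n. w i k * P $$ (Suc k, Suc l)) = gam P i * w i l" if "l < n" for i l
  proof -
    have "(\<Sum>k<n. w i k * P $$ (Suc k, Suc l)) =
        (\<Sum>j=1..gam_mult P i. c i j * (\<Sum>k<n. u_row P U i j $ k * P $$ (Suc k, Suc l)))"
      unfolding w_def sum_distrib_right sum_distrib_left by (subst sum.swap) (simp add: mult_ac)
    also have "\<dots> = (\<Sum>j=1..gam_mult P i. c i j * (gam P i * u_row P U i j $ l))"
      using u(2) that by (intro sum.cong) auto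
    finally show ?thesis by (simp add: w_def sum_distrib_left mult_ac)
  qed
  show ?thesis unfolding U_def[symmetric]
  proof
    show "size (eig_mset (del0 P)) = n" unfolding em by simp
    show "char_poly (del0 P) = (\<Prod>x\<in>#eig_mset (del0 P). [:- x, 1:])"
      unfolding em cp by (simp add: image_mset.compositionality comp_def prod_unfold_prod_mset)
    show "Lambda1 P U c \<in> carrier_mat (Suc (red_rank P)) (Suc n)"
      using P by (simp add: Lambda1_def)
    show "Lambda1 P U c $$ (0, l) = (if l = 0 then 1 else 0)" if "l < Suc n" for l
      using idx_0[of 0] idx_Suc[of 0 "l - 1"] that by (cases l) auto
    show "(\<Sum>l<Suc n. Lambda1 P U c $$ (i, l)) = 1" if "i < Suc (red_rank P)" for i
      unfolding sum.lessThan_Suc_shift using idx_0[of i] idx_Suc[of i] that by (auto simp: r_def)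
    show "(\<Sum>k<n. Lambda1 P U c $$ (i, Suc k) * P $$ (Suc k, Suc l)) =
        gam P i * Lambda1 P U c $$ (i, Suc l)" if "i \<in> {1..red_rank P}" "l < n" for i l
      using eig[OF that(2)] idx_Suc[of i] that by (auto simp: r_def)
  qed (use P st rev stat pos \<pi> in \<open>auto simp: U_def\<close>)
qed

theorem theorem3p16:
  fixes n :: nat and P V \<Lambda> :: "real mat" and \<pi> :: "real vec"
    and c :: "nat \<Rightarrow> nat \<Rightarrow> real"
  assumes "n \<ge> 1"
    and "P \<in> carrier_mat (n + 1) (n + 1)"
    and "stochastic_mat P"
    and "ergodic_mat P"
    and "stationary \<pi> P"
    and "time_reversible \<pi> P"
    and "lam P (red_rank P) \<ge> 0"
    and "orthonormal_left_eigenbasis \<pi> P V"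
    and "\<pi> = pi_star P (red_rank P) \<^sub>v* Lambda1 P (U_mat \<pi> V) c"
    and "\<Lambda> = Lambda2 P * Lambda1 P (U_mat \<pi> V) c"
  shows "\<Lambda> \<in> carrier_mat (red_rank P + 1) (n + 1) \<and>
     quasi_intertwining \<Lambda> \<pi> (absorb0 P) (pi_hat P (red_rank P)) (P_hat P) \<and>
     (\<forall>(M :: 'w measure) X (N :: 'v measure) Y.
        markov_chain M X \<pi> P \<longrightarrow>
        markov_chain N Y (pi_hat P (red_rank P)) (P_hat P) \<longrightarrow>
        law M (hitting_time0 X) = law N (hitting_time0 Y))"
proof -
  have "irreducible_mat P" using assms(4) by (simp add: ergodic_mat_def)
  then interpret stationary_decomposition n P "Lambda1 P (U_mat \<pi> V) c" \<pi>
    using assms by (intro Lambda1_decomposition) auto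
  have \<Lambda>: "\<Lambda> = Lam" using assms(10) by (simp add: Lam_def)
  have "law M (hitting_time0 X) = law N (hitting_time0 Y)"
    if X: "markov_chain M X \<pi> P" and Y: "markov_chain N Y (pi_hat P (red_rank P)) (P_hat P)"
    for M :: "'w measure" and X and N :: "'v measure" and Y
  proof (rule law_hitting_time0_eqI[where d = "Suc n" and e = "Suc (red_rank P)"])
    show "prob_space M" "prob_space N" using X Y by (simp_all add: markov_chain_def)
    show "X t \<in> measurable M (count_space {0..<Suc n})" for t
      using X carrier_matD[OF P] by (simp add: markov_chain_def)
    show "Y t \<in> measurable N (count_space {0..<Suc (red_rank P)})" for t
      using Y carrier_matD[OF P_hat_carrier[of P]] by (simp add: markov_chain_def)
    \<comment> \<open>Both survival probabilities become the surviving masses compared in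
      \<open>surviving_mass_eq\<close>.\<close>
    show "measure M (survives M X t) = measure N (survives N Y t)" for t
      unfolding measure_survives[OF X P \<pi>_carrier] measure_survives[OF Y P_hat_carrier pi_hat_carrier]
        absorb0_P_hat by (rule surviving_mass_eq)
  qed
  then show ?thesis
    using Lam_carrier Lam_quasi_link Lam_intertwines pi_hat_Lam
    unfolding \<Lambda> quasi_intertwining_def by auto
qed

end
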